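(* Let $b(n)$ be defined by $$\sum_{n=0}^{\infty} b(n)q^n = f_1^2 f_3 .$$ Let $p\ge 5$ be a prime, let $\left(\frac{\cdot}{p}\right)$ denote the Legendre symbol, and define $$\omega(p) := b\!\left(\frac{5(p^2-1)}{24}\right) + \left(\frac{-6}{p}\right)\left(\frac{-5(p^2-1)/24}{p}\right).$$ (i) If $\omega(p)\equiv 0 \pmod 2$, then for all integers $n,j\ge 0$ with $p\nmid n$, $$b_{3,8}\!\left(2p^{4j+3}n+\frac{5p^{4j+4}}{12}+\frac{7}{12}\right)\equiv 0 \pmod 2.$$ (ii) If $\omega(p)\not\equiv 0\pmod 2$, then for all integers $n,j\ge 0$: (a) if $p\nmid 24n+5$, then $$b_{3,8}\!\left(2p^{6j+2}n+\frac{5p^{6j+2}}{12}+\frac{7}{12}\right)\equiv 0 \pmod 2;$$ (b) if $p\nmid n$, then $$b_{3,8}\!\left(2p^{6j+5}n+\frac{5p^{6j+6}}{12}+\frac{7}{12}\right)\equiv 0 \pmod 2.$$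
   Context: For $|q|<1$ and a positive integer $i$, $f_i := (q^i;q^i)_\infty = \prod_{m=1}^{\infty}(1-q^{im})$. For coprime positive integers $\ell,k$, a partition is called $(\ell,k)$-regular if none of its parts is divisible by $\ell$ or by $k$; $b_{\ell,k}(n)$ denotes the number of $(\ell,k)$-regular partitions of $n$, with $b_{\ell,k}(0)=1$. Equivalently, $\sum_{n=0}^{\infty} b_{\ell,k}(n)q^n = \dfrac{f_\ell f_k}{f_1 f_{\ell k}}$. *)

theory Defs
  imports "HOL-Analysis.Analysis" "HOL-Number_Theory.Number_Theory"
begin

(* f_i = (q^i; q^i)_infinity as a formal power series in q, the infinite product
   being taken in the q-adic topology; the product index is shifted to start at 0.
   Only i > 0 is meaningful. *)
definition euler_f :: "nat \<Rightarrow> int fps" where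
  "euler_f i = prodinf (\<lambda>m. 1 - fps_X ^ (i * Suc m))"

lemma euler_f_partial_nth:
  assumes "i > 0" "k \<le> N" "k \<le> N'"
  shows "fps_nth (\<Prod>m<N. 1 - fps_X ^ (i * Suc m) :: int fps) k =
         fps_nth (\<Prod>m<N'. 1 - fps_X ^ (i * Suc m) :: int fps) k"
proof -
  let ?P = "\<lambda>N. \<Prod>m<N. 1 - fps_X ^ (i * Suc m) :: int fps"
  have "fps_nth (?P N) k = fps_nth (?P k) k" if "k \<le> N" for N
    using that
  proof (induction N rule: dec_induct)
    case (step n)
    have "Suc n \<le> i * Suc n" using assms(1) by (cases i) auto
    then have "k < i * Suc n" using step(1) by linarith
    then have "fps_nth (?P n * fps_X ^ (i * Suc n)) k = 0"
      by (simp only: fps_X_power_mult_right_nth if_True)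
    then show ?case
      using step(3) by (simp only: prod.lessThan_Suc right_diff_distrib fps_sub_nth mult_1_right diff_zero)
  qed simp
  then show ?thesis using assms by metis
qed

(* The product defining euler_f converges, so prodinf does not return a junk value. *)
lemma euler_f_has_prod:
  assumes "i > 0"
  shows "(\<lambda>m. 1 - fps_X ^ (i * Suc m)) has_prod euler_f i"
proof -
  let ?P = "\<lambda>N. \<Prod>m<N. 1 - fps_X ^ (i * Suc m) :: int fps"
  define L where "L = Abs_fps (\<lambda>k. fps_nth (?P k) k)"
  have "?P \<longlonglongrightarrow> L"
  proof (rule tendsto_fpsI)
    fix k
    show "\<forall>\<^sub>F N in sequentially. fps_nth (?P N) k = fps_nth L k"
      using eventually_ge_at_top[of k]
      by eventually_elim (unfold L_def fps_nth_Abs_fps, rule euler_f_partial_nth[OF assms], simp_all)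
  qed
  moreover have "fps_nth L 0 = 1" by (simp add: L_def)
  then have "L \<noteq> 0" by auto
  ultimately have "(\<lambda>m. 1 - fps_X ^ (i * Suc m)) has_prod L"
    unfolding has_prod_def raw_has_prod_def
    by (simp add: LIMSEQ_lessThan_iff_atMost)
  then show ?thesis
    unfolding euler_f_def using has_prod_unique by metis
qed

(* Partitions as multisets of positive integers. *)
definition regular_partitions :: "nat \<Rightarrow> nat \<Rightarrow> nat \<Rightarrow> nat multiset set" where
  "regular_partitions l k n =
     {M. sum_mset M = n \<and> (\<forall>x\<in>#M. x > 0 \<and> \<not> l dvd x \<and> \<not> k dvd x)}"

definition b_reg :: "nat \<Rightarrow> nat \<Rightarrow> nat \<Rightarrow> nat" where
  "b_reg l k n = card (regular_partitions l k n)"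

(* The set counted by b_reg is finite, so card does not return a junk value. *)
lemma finite_regular_partitions: "finite (regular_partitions l k n)"
proof (rule finite_subset)
  show "regular_partitions l k n \<subseteq> mset ` {xs. set xs \<subseteq> {..n} \<and> length xs \<le> n}"
  proof
    fix M assume M: "M \<in> regular_partitions l k n"
    obtain xs where xs: "M = mset xs" by (metis ex_mset)
    have s: "sum_list xs = n" and pos: "\<forall>x\<in>set xs. x > 0"
      using M by (auto simp: regular_partitions_def xs sum_mset_sum_list)
    have "length xs \<le> sum_list xs" using pos by (induction xs) auto
    moreover have "set xs \<subseteq> {..n}" using s member_le_sum_list by fastforce
    ultimately show "M \<in> mset ` {xs. set xs \<subseteq> {..n} \<and> length xs \<le> n}"
      using s xs by auto
  qed
  show "finite (mset ` {xs. set xs \<subseteq> {..n} \<and> length xs \<le> n})"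
    by (intro finite_imageI finite_lists_length_le) simp
qed

definition b_seq :: "nat \<Rightarrow> int" where
  "b_seq n = fps_nth (euler_f 1 ^ 2 * euler_f 3) n"

(* For primes p >= 5 both divisions by 24 are exact, see below. *)
definition omega :: "nat \<Rightarrow> int" where
  "omega p = b_seq (5 * (p ^ 2 - 1) div 24) +
     Legendre (- 6) (int p) * Legendre (- (5 * (int p ^ 2 - 1) div 24)) (int p)"

(* The divisions in omega and in the arguments of b_reg 3 8 in the theorem
   (5 p^(2 k) / 12 + 7 / 12 written over the common denominator) are exact. *)
lemma prime_square_mod_24:
  fixes p :: nat
  assumes "prime p" "p \<ge> 5"
  shows "p ^ 2 mod 24 = 1"
proof -
  have "\<not> 2 dvd p" "\<not> 3 dvd p"
    using assms primes_dvd_imp_eq[of 2 p] primes_dvd_imp_eq[of 3 p] by auto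
  then have "p mod 24 = 1 \<or> p mod 24 = 5 \<or> p mod 24 = 7 \<or> p mod 24 = 11 \<or>
             p mod 24 = 13 \<or> p mod 24 = 17 \<or> p mod 24 = 19 \<or> p mod 24 = 23"
    by presburger
  then have "(p mod 24) ^ 2 mod 24 = 1"
    by (elim disjE) simp_all
  then show ?thesis
    by (simp add: power_mod)
qed

lemma dvd_24_omega_argument:
  fixes p :: nat
  assumes "prime p" "p \<ge> 5"
  shows "24 dvd 5 * (p ^ 2 - 1)" and "24 dvd 5 * (int p ^ 2 - 1)"
proof -
  have *: "24 dvd p ^ 2 - 1"
    using prime_square_mod_24[OF assms] by presburger
  then show "24 dvd 5 * (p ^ 2 - 1)" by simp
  have "p ^ 2 \<ge> 1" using assms by simp
  then have "int (p ^ 2 - 1) = int p ^ 2 - 1" by (simp add: of_nat_diff)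
  then show "24 dvd 5 * (int p ^ 2 - 1)"
    using * by (metis dvd_mult int_dvd_int_iff of_nat_numeral)
qed

lemma dvd_12_b_reg_argument:
  fixes p :: nat
  assumes "prime p" "p \<ge> 5"
  shows "12 dvd 5 * p ^ (2 * k) + 7"
proof -
  have "p ^ (2 * k) mod 24 = (p ^ 2 mod 24) ^ k mod 24"
    by (simp add: power_mult power_mod)
  then have "p ^ (2 * k) mod 24 = 1"
    by (simp add: prime_square_mod_24[OF assms])
  then show ?thesis by presburger
qed

end

(*
  Modulo 2 one has f_2i = f_i^2, so b is the coefficient sequence of f_2 f_3, and a
  2-dissection of f_3 f_8 / (f_1 f_24) gives b_{3,8}(2n+1) = b(n).  By the pentagonal number
  theorem b(n) = A(24n+5), where A(N) counts the positive solutions of 2x^2 + 3y^2 = N with x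
  and y prime to 6.

  The numbers A(N) are governed by ideals of norm N in Z[sqrt(-6)]: the condition that 3 does not
  divide y is a ring class condition, and keeping track of y/x modulo 3 yields, modulo 2,
  A(p^2 N) + [p not dividing N] A(N) + A(N/p^2) = c A(N)  with c depending only on p.
  Here c is even if p is inert, and for split p the generator U + V sqrt(-6) of the square of a
  prime ideal above p gives c = 0 or 1 according to whether 3 divides V.  The case N = 5 identifies
  c with omega(p), and the recurrence makes A(p^(2i) M) periodic in i.
*)

theory Submission
  imports Defs "HOL-Library.Z2" "HOL-Library.Discrete_Functions"
begin

section \<open>Representations by \<open>2 x\<^sup>2 + 3 y\<^sup>2\<close>\<close>

text \<open>A solution (x, y) is the element 2x + y sqrt(-6), of norm 2N, of the ideal (2,
  sqrt(-6)). This ring has class number 2, so a prime ideal above a split p need not be principal,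
  but its square is. This is why the recurrence multiplies N by p^2, not by p.

  Multiplication by a generator U + V sqrt(-6) does not preserve the residue t of y/x modulo 3: it
  shifts t by U V. The classes t = 1 and t = -1 have the common size 2 A(N), but the class t = 0 is
  a foreign quantity, so the relation does not close on A over the integers. It closes modulo 2
  because the sign changes act freely on the class t = 0: its size is a multiple of 4 and stays even
  after the halving that turns 2 A into A.

  On the side of the series, G = f_3 f_8 / (f_1 f_24) becomes f_1^3 f_3 times f_4 / f_24 modulo 2.
  The last factor is a square, hence an even series, so only the odd part of f_1^3 f_3 matters. Its
  coefficients count x^2 + y^2 = 8e + 2 with y prime to 6; swapping the entries and a rotation of
  the plane then evaluate them.\<close>

definition rep_count :: "nat \<Rightarrow> nat" where
  "rep_count N = card {(x, y). coprime x 6 \<and> coprime y 6 \<and> 2 * x\<^sup>2 + 3 * y\<^sup>2 = N}"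

text \<open>The parameter \<open>t\<close> is the residue of \<open>y / x\<close> modulo 3, whenever 3 does not divide \<open>x\<close>.\<close>

definition reps :: "int \<Rightarrow> int \<Rightarrow> (int \<times> int) set" where
  "reps t N = {(x, y). 2 * x\<^sup>2 + 3 * y\<^sup>2 = N \<and> 3 dvd y - t * x}"

lemma finite_weighted_squares:
  fixes a b N :: int
  assumes "a > 0" "b > 0"
  shows "finite {(x, y). a * x\<^sup>2 + b * y\<^sup>2 = N}"
proof (rule finite_subset)
  have *: "\<bar>x\<bar> \<le> \<bar>N\<bar>" "\<bar>y\<bar> \<le> \<bar>N\<bar>" if "a * x\<^sup>2 + b * y\<^sup>2 = N" for x y :: int
  proof -
    have sq: "\<bar>z\<bar> \<le> z\<^sup>2" for z :: int
      using self_le_power[of "\<bar>z\<bar>" 2] by (cases "z = 0") auto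
    have "1 * x\<^sup>2 \<le> a * x\<^sup>2" "1 * y\<^sup>2 \<le> b * y\<^sup>2"
      using assms by (intro mult_right_mono; simp)+
    moreover have "0 \<le> a * x\<^sup>2" "0 \<le> b * y\<^sup>2" using assms by auto
    ultimately show "\<bar>x\<bar> \<le> \<bar>N\<bar>" "\<bar>y\<bar> \<le> \<bar>N\<bar>"
      using that sq[of x] sq[of y] by linarith+
  qed
  show "{(x, y). a * x\<^sup>2 + b * y\<^sup>2 = N} \<subseteq> {-\<bar>N\<bar>..\<bar>N\<bar>} \<times> {-\<bar>N\<bar>..\<bar>N\<bar>}"
    using * by (fastforce simp: abs_le_iff)
qed simp

lemma finite_reps: "finite (reps t N)"
  by (rule finite_subset[OF _ finite_weighted_squares[of 2 3 N]]) (auto simp: reps_def)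

lemma reps_cong: "3 dvd t - t' \<Longrightarrow> reps t N = reps t' N"
proof -
  assume "3 dvd t - t'"
  then have "3 dvd y - t * x \<longleftrightarrow> 3 dvd y - t' * x" for x y
    using dvd_add_left_iff[OF dvd_mult2[OF \<open>3 dvd t - t'\<close>, of x], of "y - t * x"]
    by (simp add: algebra_simps)
  then show ?thesis by (simp add: reps_def)
qed

text \<open>Conjugation in the ring: among the three residues modulo 3 only \<open>t = 0\<close> and
  \<open>t = 1\<close> have to be distinguished when counting.\<close>

lemma card_reps_uminus: "card (reps (- t) N) = card (reps t N)"
proof -
  have "bij_betw (\<lambda>(x, y). (x, - y)) (reps t N) (reps (- t) N)"
  proof (rule bij_betwI[where g = "\<lambda>(x, y). (x, - y)"])
    have "3 dvd - y - s * x \<longleftrightarrow> 3 dvd y - - s * x" for x y s :: int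
      using dvd_minus_iff[of 3 "y + s * x"] by (simp add: algebra_simps)
    from this[of _ "- t"] this[of _ t]
    show "(\<lambda>(x, y). (x, - y)) \<in> reps t N \<rightarrow> reps (- t) N"
      "(\<lambda>(x, y). (x, - y)) \<in> reps (- t) N \<rightarrow> reps t N"
      by (auto simp: reps_def)
  qed auto
  then show ?thesis by (simp add: bij_betw_same_card)
qed

section \<open>Sign symmetries and congruences modulo 24\<close>

lemma card_quadrants:
  fixes R :: "(int \<times> int) set"
  assumes fin: "finite R"
    and nz: "\<And>x y. (x, y) \<in> R \<Longrightarrow> x \<noteq> 0 \<and> y \<noteq> 0"
    and sym: "\<And>x y. (- x, y) \<in> R \<longleftrightarrow> (x, y) \<in> R" "\<And>x y. (x, - y) \<in> R \<longleftrightarrow> (x, y) \<in> R"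
  shows "card R = 4 * card {(x, y) \<in> R. x > 0 \<and> y > 0}"
proof -
  let ?A = "{(x, y) \<in> R. x > 0}" and ?B = "{(x, y) \<in> R. x > 0 \<and> y > 0}"
  have R: "R = ?A \<union> (\<lambda>(x, y). (- x, y)) ` ?A"
  proof (intro equalityI subsetI)
    fix z assume "z \<in> R"
    then show "z \<in> ?A \<union> (\<lambda>(x, y). (- x, y)) ` ?A"
      using nz[of "fst z" "snd z"] sym(1)[of "fst z" "snd z"]
      by (cases z; cases "fst z > 0") (auto intro!: rev_image_eqI[of "(- fst z, snd z)"])
  qed (auto simp: sym)
  have "card R = card ?A + card ((\<lambda>(x, y). (- x, y)) ` ?A)"
    by (subst (1) R, rule card_Un_disjoint) (use fin in \<open>auto intro: finite_subset[OF _ fin]\<close>)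
  also have "card ((\<lambda>(x, y). (- x, y)) ` ?A) = card ?A"
    by (rule card_image) (auto simp: inj_on_def)
  finally have 1: "card R = 2 * card ?A" by simp
  have A: "?A = ?B \<union> (\<lambda>(x, y). (x, - y)) ` ?B"
  proof (intro equalityI subsetI)
    fix z assume "z \<in> ?A"
    then show "z \<in> ?B \<union> (\<lambda>(x, y). (x, - y)) ` ?B"
      using nz[of "fst z" "snd z"] sym(2)[of "fst z" "snd z"]
      by (cases z; cases "snd z > 0") (auto intro!: rev_image_eqI[of "(fst z, - snd z)"])
  qed (auto simp: sym)
  have "card ?A = card ?B + card ((\<lambda>(x, y). (x, - y)) ` ?B)"
    by (subst A, rule card_Un_disjoint) (use fin in \<open>auto intro: finite_subset[OF _ fin]\<close>)
  also have "card ((\<lambda>(x, y). (x, - y)) ` ?B) = card ?B"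
    by (rule card_image) (auto simp: inj_on_def)
  finally show ?thesis using 1 by simp
qed

text \<open>Reflection in the second coordinate pairs the points satisfying \<open>q\<close> with
  those that do not; \<open>q\<close> will be a congruence that holds for exactly one choice of
  sign.\<close>

lemma card_half:
  fixes R :: "(int \<times> int) set"
  assumes "finite R" "\<And>x y. (x, - y) \<in> R \<longleftrightarrow> (x, y) \<in> R"
    and "\<And>x y. (x, y) \<in> R \<Longrightarrow> q x (- y) \<longleftrightarrow> \<not> q x y"
  shows "card R = 2 * card {(x, y) \<in> R. q x y}"
proof -
  let ?Q = "{(x, y) \<in> R. q x y}"
  have R: "R = ?Q \<union> (\<lambda>(x, y). (x, - y)) ` ?Q"
  proof (intro equalityI subsetI)
    fix z assume z: "z \<in> R"
    obtain x y where xy: "z = (x, y)" by (cases z)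
    show "z \<in> ?Q \<union> (\<lambda>(x, y). (x, - y)) ` ?Q"
    proof (cases "q x y")
      case False
      then have "(x, - y) \<in> ?Q" using assms(2,3) z xy by auto
      then show ?thesis unfolding xy by (intro UnI2 rev_image_eqI[of "(x, - y)"]) auto
    qed (use z xy in auto)
  qed (use assms(2) in auto)
  have "card R = card ?Q + card ((\<lambda>(x, y). (x, - y)) ` ?Q)"
  proof (subst (1) R, rule card_Un_disjoint)
    show "?Q \<inter> (\<lambda>(x, y). (x, - y)) ` ?Q = {}" using assms(3) by auto
  qed (auto intro: finite_subset[OF _ assms(1)])
  also have "card ((\<lambda>(x, y). (x, - y)) ` ?Q) = card ?Q"
    by (rule card_image) (auto simp: inj_on_def)
  finally show ?thesis by simp
qed

lemma card_positive_quadrant: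
  assumes "\<And>x y. 0 < x \<and> 0 < y \<and> (int x, int y) \<in> R \<longleftrightarrow> Q x y"
  shows "card {(x, y) \<in> R. 0 < x \<and> 0 < y} = card {(x, y). Q x y}"
proof (rule bij_betw_same_card[OF bij_betwI[where f = "\<lambda>(x, y). (nat x, nat y)" and g = "\<lambda>(x, y). (int x, int y)"]])
  show "(\<lambda>(x, y). (nat x, nat y)) \<in> {(x, y) \<in> R. 0 < x \<and> 0 < y} \<rightarrow> {(x, y). Q x y}"
    by (auto simp flip: assms)
qed (auto simp flip: assms)

lemma coprime_int_6: "coprime (int w) 6 \<longleftrightarrow> coprime w 6"
  using coprime_int_iff[of w 6] by simp

lemma coprime_6_pos: "coprime w 6 \<Longrightarrow> 0 < w" for w :: nat
  by (cases w) auto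

lemma odd_square_mod_8: "odd x \<Longrightarrow> x\<^sup>2 mod 8 = 1" for x :: int
proof -
  assume "odd x"
  then have "x mod 8 = 1 \<or> x mod 8 = 3 \<or> x mod 8 = 5 \<or> x mod 8 = 7" by presburger
  then have "(x mod 8)\<^sup>2 mod 8 = 1" by (elim disjE) simp_all
  then show ?thesis by (simp add: power_mod)
qed

lemma square_mod_3: "\<not> 3 dvd x \<Longrightarrow> x\<^sup>2 mod 3 = 1" for x :: int
proof -
  assume "\<not> 3 dvd x"
  then have "x mod 3 = 1 \<or> x mod 3 = 2" by presburger
  then have "(x mod 3)\<^sup>2 mod 3 = 1" by (elim disjE) simp_all
  then show ?thesis by (simp add: power_mod)
qed

lemma coprime_6_iff: "coprime x 6 \<longleftrightarrow> odd x \<and> \<not> 3 dvd x" for x :: int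
proof -
  have "coprime x (2 * 3) \<longleftrightarrow> coprime x 2 \<and> coprime x 3" by (rule coprime_mult_right_iff)
  moreover have "coprime x 2 \<longleftrightarrow> odd x" by (simp add: coprime_right_2_iff_odd)
  moreover have "coprime x 3 \<longleftrightarrow> \<not> 3 dvd x"
    using prime_imp_coprime[of 3 x] by (auto simp: coprime_commute dest: coprime_common_divisor)
  ultimately show ?thesis by simp
qed

lemma coprime_6_iff_nat: "coprime x 6 \<longleftrightarrow> odd x \<and> \<not> 3 dvd x" for x :: nat
proof -
  have "coprime x (2 * 3) \<longleftrightarrow> coprime x 2 \<and> coprime x 3" by (rule coprime_mult_right_iff)
  moreover have "coprime x 3 \<longleftrightarrow> \<not> 3 dvd x"
    using prime_imp_coprime[of 3 x] by (auto simp: coprime_commute dest: coprime_common_divisor)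
  ultimately show ?thesis by simp
qed

text \<open>N odd forces y odd; an even x would make N equal to 3 modulo 8; and N is not divisible
  by 3. So the only condition in \<open>rep_count\<close> that is not automatic is that 3 does not
  divide y.\<close>

lemma rep_parity:
  fixes x y N :: int
  assumes "2 * x\<^sup>2 + 3 * y\<^sup>2 = N" "N mod 24 = 5"
  shows "odd x" "odd y" "\<not> 3 dvd x"
proof -
  show y: "odd y"
  proof
    assume "even y"
    then have "even N" using assms(1) by auto
    then show False using assms(2) by presburger
  qed
  show "odd x"
  proof
    assume "even x"
    then obtain k where "x = 2 * k" ..
    then have "8 * k\<^sup>2 + 3 * y\<^sup>2 = N" using assms(1) by (simp add: power_mult_distrib)
    then show False using assms(2) odd_square_mod_8[OF y] by presburger
  qed
  show "\<not> 3 dvd x"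
  proof
    assume "3 dvd x"
    then have "3 dvd x\<^sup>2" by (simp add: power2_eq_square)
    then show False using assms by presburger
  qed
qed

text \<open>As 3 does not divide x, the condition that 3 does not divide y means y = x or y = -x
  modulo 3. The two cases are disjoint and equally large, and together they consist of four
  quadrants of \<open>rep_count N\<close> points each.\<close>

lemma card_reps_1:
  assumes "N mod 24 = 5"
  shows "card (reps 1 (int N)) = 2 * rep_count N"
proof -
  define R where "R = {(x, y). 2 * x\<^sup>2 + 3 * y\<^sup>2 = int N \<and> \<not> 3 dvd y}"
  have N: "int N mod 24 = 5" using assms by presburger
  have iff: "\<not> 3 dvd y \<longleftrightarrow> 3 dvd y - 1 * x \<or> 3 dvd y - - 1 * x"
    and excl: "\<not> (3 dvd y - 1 * x \<and> 3 dvd y - - 1 * x)" if "\<not> 3 dvd x" for x y :: int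
    using that by presburger+
  have "(x, y) \<in> R \<longleftrightarrow> (x, y) \<in> reps 1 (int N) \<or> (x, y) \<in> reps (- 1) (int N)" for x y
    unfolding R_def reps_def mem_Collect_eq prod.case
    using rep_parity(3)[OF _ N, of x y] iff[of x y] by blast
  then have R: "R = reps 1 (int N) \<union> reps (- 1) (int N)" by auto
  have disj: "reps 1 (int N) \<inter> reps (- 1) (int N) = {}"
    unfolding reps_def using rep_parity(3)[OF _ N] excl by blast
  have "card R = card (reps 1 (int N)) + card (reps (- 1) (int N))"
    unfolding R
    by (rule card_Un_disjoint) (simp_all add: finite_reps disj)
  then have 2: "card R = 2 * card (reps 1 (int N))" by (simp add: card_reps_uminus)
  have "finite R" by (simp add: R finite_reps)
  then have "card R = 4 * card {(x, y) \<in> R. x > 0 \<and> y > 0}"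
    by (rule card_quadrants) (use rep_parity(1,2)[OF _ N] in \<open>auto simp: R_def\<close>)
  also have "card {(x, y) \<in> R. x > 0 \<and> y > 0} = rep_count N"
    unfolding rep_count_def
  proof (rule card_positive_quadrant)
    fix x y
    have eq: "2 * (int x)\<^sup>2 + 3 * (int y)\<^sup>2 = int N \<longleftrightarrow> 2 * x\<^sup>2 + 3 * y\<^sup>2 = N"
      using of_nat_eq_iff[where 'a = int, of "2 * x\<^sup>2 + 3 * y\<^sup>2" N]
      by (simp only: of_nat_add of_nat_mult of_nat_power of_nat_numeral)
    show "0 < x \<and> 0 < y \<and> (int x, int y) \<in> R \<longleftrightarrow>
        coprime x 6 \<and> coprime y 6 \<and> 2 * x\<^sup>2 + 3 * y\<^sup>2 = N"
    proof (cases "2 * (int x)\<^sup>2 + 3 * (int y)\<^sup>2 = int N")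
      case True
      have "odd (int x)" "odd (int y)" "\<not> 3 dvd int x" by (rule rep_parity[OF True N])+
      then have "coprime x 6" "coprime y 6 \<longleftrightarrow> \<not> 3 dvd int y" "0 < x" "0 < y"
        by (simp_all add: coprime_6_iff odd_pos flip: coprime_int_6)
      then show ?thesis using True eq by (simp add: R_def)
    next
      case False
      then show ?thesis using eq by (simp add: R_def)
    qed
  qed
  finally show ?thesis using 2 by simp
qed

text \<open>For t = 0 both sign changes preserve the set, and no solution lies on an axis. Evenness
  alone would not suffice: this count is halved in \<open>rep_count_hecke\<close> and must then
  still be even.\<close>

lemma dvd_card_reps_0:
  assumes "N mod 24 = 5"
  shows "4 dvd card (reps 0 N)"
proof -
  have "card (reps 0 N) = 4 * card {(x, y) \<in> reps 0 N. x > 0 \<and> y > 0}"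
  proof (rule card_quadrants[OF finite_reps])
    show "x \<noteq> 0 \<and> y \<noteq> 0" if "(x, y) \<in> reps 0 N" for x y
      using rep_parity(1,2)[OF _ assms, of x y] that by (auto simp: reps_def)
  qed (auto simp: reps_def)
  then show ?thesis by simp
qed

section \<open>The Hecke relation at a split prime\<close>

lemma prime_dvd_form:
  fixes P a b N :: int
  assumes "prime P" "P > 3" "2 * a\<^sup>2 + 3 * b\<^sup>2 = N" "P dvd N"
  shows "P dvd a \<longleftrightarrow> P dvd b"
proof -
  have n: "\<not> P dvd 2" "\<not> P dvd 3" using assms(1,2) zdvd_not_zless[of 2 P] zdvd_not_zless[of 3 P] by auto
  have "P dvd 2 * a\<^sup>2 + 3 * b\<^sup>2" using assms(3,4) by simp
  then have "P dvd 2 * a\<^sup>2 \<longleftrightarrow> P dvd 3 * b\<^sup>2"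
    using dvd_add_right_iff dvd_add_left_iff by blast
  then show ?thesis using n assms(1) by (simp add: prime_dvd_mult_iff prime_dvd_power_iff)
qed

lemma reps_scale:
  assumes "prime P" "P > 3"
  shows "(P * x, P * y) \<in> reps t (P\<^sup>2 * N) \<longleftrightarrow> (x, y) \<in> reps t N"
proof -
  have "\<not> P dvd 3" using assms zdvd_not_zless[of 3 P] by auto
  then have "\<not> 3 dvd P" using assms(1) primes_dvd_imp_eq[of 3 P] by auto
  then have "3 dvd P * (y - t * x) \<longleftrightarrow> 3 dvd y - t * x"
    by (simp add: prime_dvd_mult_iff)
  moreover have "2 * (P * x)\<^sup>2 + 3 * (P * y)\<^sup>2 = P\<^sup>2 * (2 * x\<^sup>2 + 3 * y\<^sup>2)"
    by (simp add: power_mult_distrib algebra_simps)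
  moreover have "P * y - t * (P * x) = P * (y - t * x)" by (simp add: algebra_simps)
  ultimately show ?thesis using assms by (simp add: reps_def)
qed

text \<open>\<open>V_nonzero\<close> excludes the trivial elements P and -P of norm
  \<open>P\<^sup>2\<close>. What remains generates the square of one of the two prime ideals above
  P; passing from V to -V exchanges these ideals.\<close>

locale split_prime =
  fixes P U V :: int
  assumes prime_P: "prime P" and P_gt_3: "P > 3"
    and norm_P: "U\<^sup>2 + 6 * V\<^sup>2 = P\<^sup>2" and V_nonzero: "V \<noteq> 0"
begin

lemma conj: "split_prime P U (- V)"
  by standard (use prime_P P_gt_3 norm_P V_nonzero in auto)

lemma not_dvd: "\<not> P dvd 2" "\<not> P dvd 3" "\<not> P dvd 6" "\<not> 3 dvd P"
proof -
  show n: "\<not> P dvd 2" "\<not> P dvd 3" using P_gt_3 zdvd_not_zless[of 2 P] zdvd_not_zless[of 3 P] by auto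
  then show "\<not> 3 dvd P" using prime_P primes_dvd_imp_eq[of 3 P] by auto
  have "\<not> P dvd 2 * 3" using n prime_P by (simp only: prime_dvd_mult_iff simp_thms)
  then show "\<not> P dvd 6" by simp
qed

lemma not_dvd_V: "\<not> P dvd V"
proof
  assume "P dvd V"
  then have "P\<^sup>2 \<le> V\<^sup>2"
    using V_nonzero by (simp add: zdvd_imp_le)
  moreover have "0 < V\<^sup>2" using V_nonzero by simp
  moreover have "0 \<le> U\<^sup>2" by simp
  ultimately show False using norm_P by linarith
qed

lemma not_dvd_U: "\<not> P dvd U"
proof
  assume "P dvd U"
  then have "P dvd U\<^sup>2" by (simp add: power2_eq_square)
  moreover have "P dvd U\<^sup>2 + 6 * V\<^sup>2" unfolding norm_P by (simp add: power2_eq_square)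
  ultimately have "P dvd 6 * V\<^sup>2" using dvd_add_right_iff by blast
  then show False
    using not_dvd not_dvd_V prime_P by (simp add: prime_dvd_mult_iff prime_dvd_power_iff)
qed

lemma three_dvd_U: "3 dvd U\<^sup>2 - 1" "\<not> 3 dvd U"
proof -
  have "U\<^sup>2 mod 3 = 1" using square_mod_3[OF not_dvd(4)] norm_P by presburger
  then show "3 dvd U\<^sup>2 - 1" by presburger
  show "\<not> 3 dvd U" using \<open>U\<^sup>2 mod 3 = 1\<close> by (auto simp: power2_eq_square)
qed

text \<open>Identify \<open>(x, y)\<close> with the element \<open>2 x + y \<surd>-6\<close> of an ideal of \<open>\<int>[\<surd>-6]\<close>; then \<open>act\<close> is
  multiplication by \<open>U + V \<surd>-6\<close>, which generates the square of a prime ideal above \<open>P\<close>.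
  Divisibility of \<open>(x, y)\<close> by that prime ideal or by its square is tested by multiplying with
  \<open>U - V \<surd>-6\<close>; this is the condition in \<open>old_part\<close> and \<open>image_part\<close>.\<close>

definition act :: "int \<times> int \<Rightarrow> int \<times> int" where
  "act = (\<lambda>(x, y). (x * U - 3 * y * V, 2 * x * V + y * U))"

definition image_part :: "int \<Rightarrow> int \<Rightarrow> (int \<times> int) set" where
  "image_part t N = {(x, y) \<in> reps t (P\<^sup>2 * N). P\<^sup>2 dvd x * U + 3 * y * V \<and> P\<^sup>2 dvd y * U - 2 * x * V}"

definition new_part :: "int \<Rightarrow> int \<Rightarrow> (int \<times> int) set" where
  "new_part t N = {(x, y) \<in> image_part t N. \<not> (P dvd x \<and> P dvd y)}"

definition old_part :: "int \<Rightarrow> int \<Rightarrow> (int \<times> int) set" where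
  "old_part t N = {(x, y) \<in> reps t N. P dvd x * U + 3 * y * V \<and> P dvd y * U - 2 * x * V}"

text \<open>The form is multiplied by the norm \<open>P\<^sup>2\<close> of the generator. Modulo 3
  the square of U is 1 and 2 = -1, so the new y - t x is U (y - (t + U V) x): this is the shift of
  the residue by U V.\<close>

lemma act_mem_reps: "act (x, y) \<in> reps t (P\<^sup>2 * N) \<longleftrightarrow> (x, y) \<in> reps (t + U * V) N"
proof -
  have "2 * (x * U - 3 * y * V)\<^sup>2 + 3 * (2 * x * V + y * U)\<^sup>2 = (U\<^sup>2 + 6 * V\<^sup>2) * (2 * x\<^sup>2 + 3 * y\<^sup>2)"
    by (simp add: power2_eq_square algebra_simps)
  also have "\<dots> = P\<^sup>2 * (2 * x\<^sup>2 + 3 * y\<^sup>2)" by (simp add: norm_P)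
  finally have 1: "2 * (x * U - 3 * y * V)\<^sup>2 + 3 * (2 * x * V + y * U)\<^sup>2 = P\<^sup>2 * N \<longleftrightarrow> 2 * x\<^sup>2 + 3 * y\<^sup>2 = N"
    using P_gt_3 by simp
  have "2 * x * V + y * U - t * (x * U - 3 * y * V) =
      U * (y - (t + U * V) * x) + ((U\<^sup>2 - 1) * (V * x) + 3 * (V * x + t * y * V))"
    by (simp add: power2_eq_square algebra_simps)
  moreover have "3 dvd (U\<^sup>2 - 1) * (V * x) + 3 * (V * x + t * y * V)"
    using three_dvd_U(1) by (intro dvd_add) (auto simp del: right_diff_distrib left_diff_distrib)
  ultimately have "3 dvd 2 * x * V + y * U - t * (x * U - 3 * y * V) \<longleftrightarrow> 3 dvd U * (y - (t + U * V) * x)"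
    by (simp only: dvd_add_left_iff)
  also have "\<dots> \<longleftrightarrow> 3 dvd y - (t + U * V) * x"
    using three_dvd_U(2) by (subst prime_dvd_mult_iff) simp_all
  finally show ?thesis using 1 by (simp add: act_def reps_def)
qed

lemma act_inverse:
  "(x * U - 3 * y * V) * U + 3 * (2 * x * V + y * U) * V = P\<^sup>2 * x"
  "(2 * x * V + y * U) * U - 2 * (x * U - 3 * y * V) * V = P\<^sup>2 * y"
  unfolding norm_P[symmetric] by (simp_all add: power2_eq_square algebra_simps)

text \<open>The inverse is multiplication by U - V sqrt(-6) followed by division by
  \<open>P\<^sup>2\<close>; the two divisibilities in \<open>image_part\<close> say that this
  quotient is integral.\<close>

lemma bij_betw_act: "bij_betw act (reps (t + U * V) N) (image_part t N)"
proof (rule bij_betw_imageI)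
  show "inj_on act (reps (t + U * V) N)"
  proof (rule inj_onI, clarsimp simp: act_def)
    fix x y x' y'
    assume "x * U - 3 * y * V = x' * U - 3 * y' * V" "2 * x * V + y * U = 2 * x' * V + y' * U"
    then have "P\<^sup>2 * x = P\<^sup>2 * x'" "P\<^sup>2 * y = P\<^sup>2 * y'" by (metis act_inverse)+
    then show "x = x' \<and> y = y'" using P_gt_3 by simp
  qed
  show "act ` reps (t + U * V) N = image_part t N"
  proof (intro equalityI subsetI)
    fix z assume "z \<in> act ` reps (t + U * V) N"
    then obtain x y where *: "z = act (x, y)" "(x, y) \<in> reps (t + U * V) N" by auto
    then show "z \<in> image_part t N"
      using act_mem_reps[of x y t N] act_inverse[of x y] by (auto simp: image_part_def act_def)
  next
    fix z assume z: "z \<in> image_part t N"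
    obtain x y where xy: "z = (x, y)" by (cases z)
    from z obtain a b where ab: "x * U + 3 * y * V = P\<^sup>2 * a" "y * U - 2 * x * V = P\<^sup>2 * b"
      and mem: "(x, y) \<in> reps t (P\<^sup>2 * N)"
      by (auto simp: image_part_def xy elim!: dvdE)
    have "P\<^sup>2 * (a * U - 3 * b * V) = (P\<^sup>2 * a) * U - 3 * (P\<^sup>2 * b) * V"
      "P\<^sup>2 * (2 * a * V + b * U) = 2 * (P\<^sup>2 * a) * V + (P\<^sup>2 * b) * U" by (simp_all add: power2_eq_square algebra_simps)
    then have "P\<^sup>2 * (a * U - 3 * b * V) = (U\<^sup>2 + 6 * V\<^sup>2) * x"
      "P\<^sup>2 * (2 * a * V + b * U) = (U\<^sup>2 + 6 * V\<^sup>2) * y"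
      unfolding ab[symmetric] by (simp_all add: power2_eq_square algebra_simps)
    then have "act (a, b) = z"
      using P_gt_3 by (simp add: norm_P act_def xy)
    then show "z \<in> act ` reps (t + U * V) N"
      using mem act_mem_reps[of a b t N] xy by (metis image_eqI)
  qed
qed

lemma finite_parts: "finite (image_part t N)" "finite (new_part t N)" "finite (old_part t N)"
  by (rule finite_subset[OF _ finite_reps[of t "P\<^sup>2 * N"]], force simp: image_part_def new_part_def)+
    (rule finite_subset[OF _ finite_reps[of t N]], force simp: old_part_def)

text \<open>An element of the squared prime ideal that is divisible by P equals P times an element
  of the prime ideal itself. So the imprimitive part of the image is a scaled copy of
  \<open>old_part\<close>.\<close>

lemma card_new_old: "card (reps (t + U * V) N) = card (new_part t N) + card (old_part t N)"
proof -
  have *: "image_part t N = new_part t N \<union> (\<lambda>(x, y). (P * x, P * y)) ` old_part t N"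
  proof (intro equalityI subsetI)
    fix z assume z: "z \<in> image_part t N"
    show "z \<in> new_part t N \<union> (\<lambda>(x, y). (P * x, P * y)) ` old_part t N"
    proof (cases "P dvd fst z \<and> P dvd snd z")
      case True
      then obtain x y where xy: "z = (P * x, P * y)" by (cases z) (auto elim!: dvdE)
      have "P * x * U + 3 * (P * y) * V = P * (x * U + 3 * y * V)"
        "P * y * U - 2 * (P * x) * V = P * (y * U - 2 * x * V)" by (simp_all add: power2_eq_square algebra_simps)
      then have "(x, y) \<in> old_part t N"
        using z P_gt_3 reps_scale[OF prime_P P_gt_3]
        by (simp add: xy image_part_def old_part_def power2_eq_square[of P] mult.assoc)
      then show ?thesis by (auto simp: xy)
    qed (use z in \<open>auto simp: new_part_def\<close>)
  next
    fix z assume "z \<in> new_part t N \<union> (\<lambda>(x, y). (P * x, P * y)) ` old_part t N"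
    then show "z \<in> image_part t N"
    proof
      assume "z \<in> (\<lambda>(x, y). (P * x, P * y)) ` old_part t N"
      then obtain x y where xy: "z = (P * x, P * y)" "(x, y) \<in> old_part t N" by auto
      have "P * x * U + 3 * (P * y) * V = P * (x * U + 3 * y * V)"
        "P * y * U - 2 * (P * x) * V = P * (y * U - 2 * x * V)" by (simp_all add: power2_eq_square algebra_simps)
      then show ?thesis
        using xy P_gt_3 reps_scale[OF prime_P P_gt_3]
        by (simp add: image_part_def old_part_def power2_eq_square[of P] mult.assoc)
    qed (auto simp: new_part_def)
  qed
  have "card (reps (t + U * V) N) = card (image_part t N)"
    by (rule bij_betw_same_card[OF bij_betw_act])
  also have "\<dots> = card (new_part t N) + card ((\<lambda>(x, y). (P * x, P * y)) ` old_part t N)"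
    unfolding *
  proof (rule card_Un_disjoint)
    show "new_part t N \<inter> (\<lambda>(x, y). (P * x, P * y)) ` old_part t N = {}"
      by (auto simp: new_part_def)
  qed (simp_all add: finite_parts)
  also have "card ((\<lambda>(x, y). (P * x, P * y)) ` old_part t N) = card (old_part t N)"
    by (rule card_image) (use P_gt_3 in \<open>auto simp: inj_on_def\<close>)
  finally show ?thesis .
qed


text \<open>The two factors test membership in the two conjugate prime ideals (or in their squares).
  If P or \<open>P\<^sup>2\<close> divides N, it divides their product, and it only remains to see
  how it is distributed.\<close>

lemma product_identity:
  assumes "2 * x\<^sup>2 + 3 * y\<^sup>2 = N"
  shows "(x * U + 3 * y * V) * (x * U + 3 * y * - V) = P\<^sup>2 * x\<^sup>2 - 3 * V\<^sup>2 * N"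
  unfolding assms[symmetric] norm_P[symmetric] by (simp add: power2_eq_square algebra_simps)

lemma square_dvd_factor:
  assumes "P\<^sup>2 dvd a * b" "\<not> (P dvd a \<and> P dvd b)"
  shows "P\<^sup>2 dvd a \<or> P\<^sup>2 dvd b"
proof (cases "P dvd a")
  case True
  then have "coprime (P\<^sup>2) b" using assms(2) prime_P by (simp add: prime_imp_coprime)
  then show ?thesis using assms(1) coprime_dvd_mult_left_iff by blast
next
  case False
  then have "coprime (P\<^sup>2) a" using prime_P by (simp add: prime_imp_coprime)
  then show ?thesis using assms(1) coprime_dvd_mult_right_iff by blast
qed

lemma norm_conj_act:
  assumes "2 * x\<^sup>2 + 3 * y\<^sup>2 = N"
  shows "2 * (x * U + 3 * y * V)\<^sup>2 + 3 * (y * U - 2 * x * V)\<^sup>2 = P\<^sup>2 * N"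
  unfolding assms[symmetric] norm_P[symmetric] by (simp add: power2_eq_square algebra_simps)

text \<open>The product of (x, y) with U - V sqrt(-6) has form value \<open>P ^ 4 * N\<close>, so a
  first coordinate divisible by \<open>P\<^sup>2\<close> forces the same for the second.\<close>

lemma image_part_iff:
  assumes "(x, y) \<in> reps t (P\<^sup>2 * N)"
  shows "(x, y) \<in> image_part t N \<longleftrightarrow> P\<^sup>2 dvd x * U + 3 * y * V"
proof -
  have "P\<^sup>2 dvd y * U - 2 * x * V" if "P\<^sup>2 dvd x * U + 3 * y * V"
  proof -
    have "2 * x\<^sup>2 + 3 * y\<^sup>2 = P\<^sup>2 * N" using assms by (simp add: reps_def)
    from norm_conj_act[OF this]
    have "3 * (y * U - 2 * x * V)\<^sup>2 = (P\<^sup>2)\<^sup>2 * N - 2 * (x * U + 3 * y * V)\<^sup>2"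
      by (simp add: power2_eq_square mult.assoc)
    also have "(P\<^sup>2)\<^sup>2 dvd \<dots>"
      using that by (intro dvd_diff[OF dvd_triv_left] dvd_mult dvd_power_same)
    finally have "(P\<^sup>2)\<^sup>2 dvd 3 * (y * U - 2 * x * V)\<^sup>2" .
    moreover have "coprime ((P\<^sup>2)\<^sup>2) 3"
      using not_dvd(2) prime_P by (simp add: prime_imp_coprime)
    ultimately have "(P\<^sup>2)\<^sup>2 dvd (y * U - 2 * x * V)\<^sup>2"
      by (simp only: coprime_dvd_mult_right_iff)
    then show ?thesis by (simp only: pow_divides_pow_iff zero_less_numeral)
  qed
  then show ?thesis using assms by (auto simp: image_part_def)
qed

lemma old_part_iff:
  assumes "(x, y) \<in> reps t N"
  shows "(x, y) \<in> old_part t N \<longleftrightarrow> P dvd x * U + 3 * y * V"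
proof -
  have eq: "2 * x\<^sup>2 + 3 * y\<^sup>2 = N" using assms by (simp add: reps_def)
  have "P dvd P\<^sup>2 * N" by (simp add: power2_eq_square)
  from prime_dvd_form[OF prime_P P_gt_3 norm_conj_act[OF eq] this]
  show ?thesis using assms by (auto simp: old_part_def)
qed

text \<open>The sum of the two tests is 2 x U, and P divides neither 2 nor U. In terms of ideals:
  lying in both conjugate primes means being divisible by their product P.\<close>

lemma both_factors_dvd:
  assumes "2 * x\<^sup>2 + 3 * y\<^sup>2 = N" "P dvd N"
  shows "P dvd x * U + 3 * y * V \<and> P dvd x * U + 3 * y * - V \<longleftrightarrow> P dvd x \<and> P dvd y"
proof (intro iffI)
  assume *: "P dvd x * U + 3 * y * V \<and> P dvd x * U + 3 * y * - V"
  then have "P dvd (x * U + 3 * y * V) + (x * U + 3 * y * - V)" using dvd_add by blast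
  then have "P dvd 2 * (x * U)" by (simp add: mult.commute)
  then have "P dvd x" using not_dvd(1) not_dvd_U prime_P by (simp add: prime_dvd_mult_iff)
  then show "P dvd x \<and> P dvd y" using prime_dvd_form[OF prime_P P_gt_3 assms] by simp
next
  assume "P dvd x \<and> P dvd y"
  then have "P dvd x * U" "P dvd 3 * y * V" "P dvd 3 * y * - V" by auto
  then show "P dvd x * U + 3 * y * V \<and> P dvd x * U + 3 * y * - V"
    by (intro conjI dvd_add)
qed

text \<open>If (x, y) is not divisible by P, at most one of the two tests is divisible by P. That
  one must then absorb the whole factor \<open>P\<^sup>2\<close> of the product, which places the
  element in one of the two squared prime ideals.\<close>

lemma reps_decomposition:
  "reps t (P\<^sup>2 * N) = (\<lambda>(x, y). (P * x, P * y)) ` reps t N \<union>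
     (new_part t N \<union> split_prime.new_part P U (- V) t N)"
proof (intro equalityI subsetI)
  interpret conj: split_prime P U "- V" by (rule conj)
  fix z assume z: "z \<in> reps t (P\<^sup>2 * N)"
  show "z \<in> (\<lambda>(x, y). (P * x, P * y)) ` reps t N \<union> (new_part t N \<union> conj.new_part t N)"
  proof (cases "P dvd fst z \<and> P dvd snd z")
    case True
    then obtain x y where xy: "z = (P * x, P * y)" by (cases z) (auto elim!: dvdE)
    then show ?thesis using z reps_scale[OF prime_P P_gt_3] by auto
  next
    case False
    obtain x y where xy: "z = (x, y)" by (cases z)
    have eq: "2 * x\<^sup>2 + 3 * y\<^sup>2 = P\<^sup>2 * N" using z by (simp add: xy reps_def)
    have "P\<^sup>2 dvd (x * U + 3 * y * V) * (x * U + 3 * y * - V)"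
      unfolding product_identity[OF eq] by (intro dvd_diff) auto
    moreover have "P dvd P\<^sup>2 * N" by (simp add: power2_eq_square)
    ultimately have "P\<^sup>2 dvd x * U + 3 * y * V \<or> P\<^sup>2 dvd x * U + 3 * y * - V"
      using both_factors_dvd[OF eq] False by (intro square_dvd_factor) (auto simp: xy)
    then show ?thesis
      using False z image_part_iff[of x y t N] conj.image_part_iff[of x y t N]
      unfolding xy new_part_def conj.new_part_def by auto
  qed
next
  interpret conj: split_prime P U "- V" by (rule conj)
  fix z assume "z \<in> (\<lambda>(x, y). (P * x, P * y)) ` reps t N \<union> (new_part t N \<union> conj.new_part t N)"
  then show "z \<in> reps t (P\<^sup>2 * N)"
    using reps_scale[OF prime_P P_gt_3]
    by (auto simp: new_part_def image_part_def conj.new_part_def conj.image_part_def)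
qed

lemma card_scaled: "card ((\<lambda>(x, y). (P * x, P * y)) ` A) = card A"
  by (rule card_image) (use P_gt_3 in \<open>auto simp: inj_on_def\<close>)

lemma card_decomposition:
  "card (reps t (P\<^sup>2 * N)) = card (reps t N) + card (new_part t N) + card (split_prime.new_part P U (- V) t N)"
proof -
  interpret conj: split_prime P U "- V" by (rule conj)
  have "new_part t N \<inter> conj.new_part t N = {}"
  proof (intro equalityI subsetI)
    fix z assume z: "z \<in> new_part t N \<inter> conj.new_part t N"
    obtain x y where xy: "z = (x, y)" by (cases z)
    have eq: "2 * x\<^sup>2 + 3 * y\<^sup>2 = P\<^sup>2 * N"
      and dvd: "P\<^sup>2 dvd x * U + 3 * y * V" "P\<^sup>2 dvd x * U + 3 * y * - V"
      and n: "\<not> (P dvd x \<and> P dvd y)"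
      using z by (auto simp: xy new_part_def image_part_def conj.new_part_def conj.image_part_def reps_def)
    have "P dvd P\<^sup>2" "P dvd P\<^sup>2 * N" by (simp_all add: power2_eq_square)
    then show "z \<in> {}" using both_factors_dvd[OF eq] dvd n by (meson dvd_trans)
  qed auto
  then have 1: "card (new_part t N \<union> conj.new_part t N) = card (new_part t N) + card (conj.new_part t N)"
    by (intro card_Un_disjoint finite_parts conj.finite_parts)
  have "card (reps t (P\<^sup>2 * N)) =
      card ((\<lambda>(x, y). (P * x, P * y)) ` reps t N) + card (new_part t N \<union> conj.new_part t N)"
    unfolding reps_decomposition
  proof (rule card_Un_disjoint)
    show "(\<lambda>(x, y). (P * x, P * y)) ` reps t N \<inter> (new_part t N \<union> conj.new_part t N) = {}"
      by (auto simp: new_part_def conj.new_part_def)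
  qed (simp_all add: finite_parts conj.finite_parts finite_reps)
  then show ?thesis by (simp add: 1 card_scaled)
qed

text \<open>Elements of value N lie in neither prime ideal above P, so both old parts are empty and
  each new part has the size of a full shifted count.\<close>

lemma hecke_coprime:
  assumes "\<not> P dvd N"
  shows "card (reps t (P\<^sup>2 * N)) = card (reps t N) + card (reps (t + U * V) N) + card (reps (t - U * V) N)"
proof -
  interpret conj: split_prime P U "- V" by (rule conj)
  have no: "\<not> P dvd x * U + 3 * y * W" if "2 * x\<^sup>2 + 3 * y\<^sup>2 = N" "W = V \<or> W = - V" for x y W
  proof
    assume "P dvd x * U + 3 * y * W"
    then have "P dvd (x * U + 3 * y * V) * (x * U + 3 * y * - V)" using that(2) by auto
    then have "P dvd P\<^sup>2 * x\<^sup>2 - 3 * V\<^sup>2 * N" unfolding product_identity[OF that(1)] .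
    moreover have "P dvd P\<^sup>2 * x\<^sup>2" by (simp add: power2_eq_square)
    ultimately have "P dvd 3 * V\<^sup>2 * N" using dvd_diff_right_iff by blast
    then show False
      using not_dvd(2) not_dvd_V assms prime_P by (simp add: prime_dvd_mult_iff prime_dvd_power_iff)
  qed
  have "old_part t N = {}" "conj.old_part t N = {}"
    using no[of _ _ V] no[of _ _ "- V"] by (auto simp: old_part_def conj.old_part_def reps_def)
  then show ?thesis
    using card_decomposition[of t N] card_new_old[of t N] conj.card_new_old[of t N] by simp
qed

text \<open>Every element of value N now lies in one of the two prime ideals, and in both iff it is
  divisible by P. By inclusion-exclusion the old parts add up to the count for N plus that for
  \<open>N div P\<^sup>2\<close>; the former cancels the scaled copy in
  \<open>card_decomposition\<close>.\<close>

lemma hecke_dvd: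
  assumes "P dvd N"
  shows "card (reps t (P\<^sup>2 * N)) + (if P\<^sup>2 dvd N then card (reps t (N div P\<^sup>2)) else 0) =
    card (reps (t + U * V) N) + card (reps (t - U * V) N)"
proof -
  interpret conj: split_prime P U "- V" by (rule conj)
  have un: "old_part t N \<union> conj.old_part t N = reps t N"
  proof (intro equalityI subsetI)
    fix z assume z: "z \<in> reps t N"
    obtain x y where xy: "z = (x, y)" by (cases z)
    have eq: "2 * x\<^sup>2 + 3 * y\<^sup>2 = N" using z by (simp add: xy reps_def)
    have "P dvd (x * U + 3 * y * V) * (x * U + 3 * y * - V)"
      unfolding product_identity[OF eq] using assms by (intro dvd_diff) (auto simp: power2_eq_square)
    then show "z \<in> old_part t N \<union> conj.old_part t N"
      using old_part_iff[of x y t N] conj.old_part_iff[of x y t N] z prime_P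
      unfolding xy by (auto simp only: prime_dvd_mult_iff)
  qed (auto simp: old_part_def conj.old_part_def)
  have int: "card (old_part t N \<inter> conj.old_part t N) =
      (if P\<^sup>2 dvd N then card (reps t (N div P\<^sup>2)) else 0)"
  proof -
    have iff: "z \<in> old_part t N \<inter> conj.old_part t N \<longleftrightarrow> z \<in> reps t N \<and> P dvd fst z \<and> P dvd snd z" for z
    proof (cases "z \<in> reps t N")
      case True
      obtain x y where xy: "z = (x, y)" by (cases z)
      have eq: "2 * x\<^sup>2 + 3 * y\<^sup>2 = N" using True by (simp add: xy reps_def)
      show ?thesis
        using both_factors_dvd[OF eq assms] old_part_iff[of x y t N] conj.old_part_iff[of x y t N] True
        unfolding xy by auto
    qed (auto simp: old_part_def)
    show ?thesis
    proof (cases "P\<^sup>2 dvd N")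
      case True
      then obtain M where N: "N = P\<^sup>2 * M" ..
      have "z \<in> old_part t N \<inter> conj.old_part t N \<longleftrightarrow> z \<in> (\<lambda>(x, y). (P * x, P * y)) ` reps t M" for z
        unfolding iff unfolding N
        using reps_scale[OF prime_P P_gt_3, of _ _ t M]
        by (cases z) (auto elim!: dvdE)
      then have "old_part t N \<inter> conj.old_part t N = (\<lambda>(x, y). (P * x, P * y)) ` reps t M" by blast
      moreover have "N div P\<^sup>2 = M" using N P_gt_3 by simp
      ultimately show ?thesis using True by (simp add: card_scaled)
    next
      case False
      have "\<not> (P dvd x \<and> P dvd y)" if "2 * x\<^sup>2 + 3 * y\<^sup>2 = N" for x y
      proof
        assume "P dvd x \<and> P dvd y"
        then have "P\<^sup>2 dvd 2 * x\<^sup>2 + 3 * y\<^sup>2" by (intro dvd_add dvd_mult dvd_power_same) auto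
        then show False using that False by simp
      qed
      then have "old_part t N \<inter> conj.old_part t N = {}"
        using iff unfolding reps_def by fastforce
      then show ?thesis using False by simp
    qed
  qed
  have "card (old_part t N) + card (conj.old_part t N) =
      card (reps t N) + (if P\<^sup>2 dvd N then card (reps t (N div P\<^sup>2)) else 0)"
    using card_Un_Int[OF finite_parts(3) conj.finite_parts(3), of t N t N] by (simp only: un int)
  then show ?thesis
    using card_decomposition[of t N] card_new_old[of t N] conj.card_new_old[of t N] by simp
qed

end

section \<open>Split and inert primes\<close>

text \<open>The asymmetric bounds give \<open>a\<^sup>2 + 6 b\<^sup>2 \<le> 5 p\<close>, with equality only if \<open>a\<^sup>2 = 2 p\<close>; so
  \<open>a\<^sup>2 + 6 b\<^sup>2 = k p\<close> with \<open>k \<le> 4\<close>, and each such \<open>k\<close> is easy to remove.\<close>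

lemma thue_pair:
  fixes p :: nat and s :: int
  assumes "p > 0"
  obtains a b :: int where "(a, b) \<noteq> (0, 0)" "a\<^sup>2 \<le> 2 * int p" "2 * b\<^sup>2 \<le> int p" "int p dvd a - s * b"
proof -
  define X Y where "X = floor_sqrt (2 * p)" and "Y = floor_sqrt (p div 2)"
  have X: "X\<^sup>2 \<le> 2 * p" "2 * p < (Suc X)\<^sup>2" and Y: "Y\<^sup>2 \<le> p div 2" "p div 2 < (Suc Y)\<^sup>2"
    by (simp_all add: X_def Y_def Suc_floor_sqrt_power2_gt)
  have "p < 2 * (Suc Y)\<^sup>2" using Y(2) by linarith
  with X(2) have "2 * p * p < (Suc X)\<^sup>2 * (2 * (Suc Y)\<^sup>2)"
    using assms by (intro mult_strict_mono) auto
  then have "p\<^sup>2 < (Suc X * Suc Y)\<^sup>2" by (simp add: power2_eq_square algebra_simps)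
  then have less: "p < Suc X * Suc Y" by (rule power_less_imp_less_base) simp
  define f where "f = (\<lambda>(i, j). (int i - s * int j) mod int p)"
  have "f ` ({..X} \<times> {..Y}) \<subseteq> {0..<int p}"
    using assms by (auto simp: f_def)
  then have "card (f ` ({..X} \<times> {..Y})) \<le> card {0..<int p}" by (intro card_mono) auto
  also have "\<dots> < card ({..X} \<times> {..Y})" using less by (simp add: card_cartesian_product)
  finally have "\<not> inj_on f ({..X} \<times> {..Y})" by (rule pigeonhole)
  then obtain i j i' j' where ij: "i \<le> X" "i' \<le> X" "j \<le> Y" "j' \<le> Y" "(i, j) \<noteq> (i', j')" "f (i, j) = f (i', j')"
    by (auto simp: inj_on_def)
  show ?thesis
  proof (rule that)
    show "(int i - int i', int j - int j') \<noteq> (0, 0)" using ij by auto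
    have "\<bar>int i - int i'\<bar> \<le> \<bar>int X\<bar>" using ij by auto
    then have "(int i - int i')\<^sup>2 \<le> (int X)\<^sup>2" by (simp only: abs_le_square_iff)
    also have "\<dots> \<le> int (2 * p)" using X(1) by (metis of_nat_le_iff of_nat_power)
    finally show "(int i - int i')\<^sup>2 \<le> 2 * int p" by simp
    have "\<bar>int j - int j'\<bar> \<le> \<bar>int Y\<bar>" using ij by auto
    then have "(int j - int j')\<^sup>2 \<le> (int Y)\<^sup>2" by (simp only: abs_le_square_iff)
    also have "\<dots> \<le> int (p div 2)" using Y(1) by (metis of_nat_le_iff of_nat_power)
    finally show "2 * (int j - int j')\<^sup>2 \<le> int p" by linarith
    have "int p dvd (int i - s * int j) - (int i' - s * int j')"
      using ij(6) by (simp add: f_def mod_eq_dvd_iff)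
    then show "int p dvd (int i - int i') - s * (int j - int j')" by (simp add: algebra_simps)
  qed
qed

text \<open>The alternatives are the two classes of forms of discriminant -24. A Thue pair satisfies
  a = s b modulo p, hence p divides \<open>a\<^sup>2 + 6 * b\<^sup>2\<close>; the cofactors 1 and 4
  lead to the principal form, 2 and 3 to the other one.\<close>

lemma prime_represented:
  fixes p :: nat and s :: int
  assumes "prime p" "p \<ge> 5" "int p dvd s\<^sup>2 + 6"
  obtains u v :: int where "u\<^sup>2 + 6 * v\<^sup>2 = int p \<or> 2 * u\<^sup>2 + 3 * v\<^sup>2 = int p"
proof -
  obtain a b :: int where ab: "(a, b) \<noteq> (0, 0)" "a\<^sup>2 \<le> 2 * int p" "2 * b\<^sup>2 \<le> int p" "int p dvd a - s * b"
    using thue_pair[of p s] assms(2) by auto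
  have P: "prime (int p)" using assms(1) by simp
  have "a\<^sup>2 + 6 * b\<^sup>2 = (a - s * b) * (a + s * b) + (s\<^sup>2 + 6) * b\<^sup>2"
    by (simp add: power2_eq_square algebra_simps)
  also have "int p dvd \<dots>" using dvd_mult2[OF ab(4)] dvd_mult2[OF assms(3)] by (rule dvd_add)
  finally obtain k where k: "a\<^sup>2 + 6 * b\<^sup>2 = int p * k" by (elim dvdE)
  have "0 < a\<^sup>2 + 6 * b\<^sup>2"
    using ab(1) by (auto simp: add_pos_nonneg add_nonneg_pos)
  then have "k > 0" using k assms(2) by (simp add: zero_less_mult_iff)
  have "a\<^sup>2 \<noteq> 2 * int p"
  proof
    assume a: "a\<^sup>2 = 2 * int p"
    then have "int p dvd a\<^sup>2" by simp
    then have "int p dvd a" using P prime_dvd_power by blast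
    then have "(int p)\<^sup>2 dvd 2 * int p" unfolding a[symmetric] by (rule dvd_power_same)
    then have "int p dvd 2" using assms(2) by (simp add: power2_eq_square)
    then show False using assms(2) zdvd_not_zless[of 2 "int p"] by simp
  qed
  then have "int p * k < int p * 5" using ab(2,3) k by linarith
  then have "k < 5" using assms(2) by simp
  with \<open>k > 0\<close> consider "k = 1" | "k = 2" | "k = 3" | "k = 4" by linarith
  then show ?thesis
  proof cases
    case 1
    then show ?thesis using k that[of a b] by simp
  next
    case 2
    then have "a\<^sup>2 = 2 * (int p - 3 * b\<^sup>2)" using k by simp
    then have "even (a\<^sup>2)" by simp
    then obtain c where c: "a = 2 * c" by auto
    have "2 * c\<^sup>2 + 3 * b\<^sup>2 = int p" using k 2 by (simp add: c power_mult_distrib)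
    then show ?thesis using that by blast
  next
    case 3
    then have "a\<^sup>2 = 3 * (int p - 2 * b\<^sup>2)" using k by simp
    then have "3 dvd a\<^sup>2" by simp
    then have "3 dvd a" by (rule prime_dvd_power[rotated]) simp
    then obtain c where c: "a = 3 * c" ..
    have "2 * b\<^sup>2 + 3 * c\<^sup>2 = int p" using k 3 by (simp add: c power_mult_distrib)
    then show ?thesis using that by blast
  next
    case 4
    then have "a\<^sup>2 = 2 * (2 * int p - 3 * b\<^sup>2)" using k by simp
    then have "even (a\<^sup>2)" by simp
    then obtain c where c: "a = 2 * c" by auto
    have *: "2 * c\<^sup>2 + 3 * b\<^sup>2 = 2 * int p" using k 4 by (simp add: c power_mult_distrib)
    then have "3 * b\<^sup>2 = 2 * (int p - c\<^sup>2)" by simp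
    then have "even (3 * b\<^sup>2)" by (metis dvd_triv_left)
    then obtain d where d: "b = 2 * d" by auto
    have "c\<^sup>2 + 6 * d\<^sup>2 = int p" using * by (simp add: d power_mult_distrib)
    then show ?thesis using that by blast
  qed
qed

lemma prime_not_square: "prime p \<Longrightarrow> p \<noteq> u\<^sup>2" for p u :: int
  by (auto simp: prime_power_iff)

text \<open>In the principal case U + V sqrt(-6) is the square of u + v sqrt(-6). In the other case
  it is half the square of 2u + v sqrt(-6), an element of norm 2p.\<close>

lemma split_prime_exists:
  fixes p :: nat and s :: int
  assumes "prime p" "p \<ge> 5" "int p dvd s\<^sup>2 + 6"
  obtains U V where "split_prime (int p) U V"
proof -
  obtain u v :: int where uv: "u\<^sup>2 + 6 * v\<^sup>2 = int p \<or> 2 * u\<^sup>2 + 3 * v\<^sup>2 = int p"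
    using prime_represented[OF assms] by blast
  have P: "prime (int p)" using assms(1) by simp
  have "u \<noteq> 0"
  proof
    assume "u = 0"
    then have "3 * (2 * v\<^sup>2) = int p \<or> 3 * v\<^sup>2 = int p" using uv by auto
    then have "3 dvd int p" by (metis dvd_triv_left)
    then show False using P assms(2) primes_dvd_imp_eq[of 3 "int p"] by simp
  qed
  have "v \<noteq> 0"
  proof
    assume "v = 0"
    then have "u\<^sup>2 = int p \<or> 2 * u\<^sup>2 = int p" using uv by auto
    then show False
    proof
      assume "2 * u\<^sup>2 = int p"
      then have "2 dvd int p" by (metis dvd_triv_left)
      then show False using P assms(2) primes_dvd_imp_eq[of 2 "int p"] by simp
    qed (use prime_not_square[OF P, of u] in simp)
  qed
  from uv show ?thesis
  proof
    assume eq: "u\<^sup>2 + 6 * v\<^sup>2 = int p"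
    have "(u\<^sup>2 - 6 * v\<^sup>2)\<^sup>2 + 6 * (2 * u * v)\<^sup>2 = (int p)\<^sup>2"
      unfolding eq[symmetric] by (simp add: power2_eq_square algebra_simps)
    then show ?thesis
      using P assms(2) \<open>u \<noteq> 0\<close> \<open>v \<noteq> 0\<close> by (intro that[of "u\<^sup>2 - 6 * v\<^sup>2" "2 * u * v"] split_prime.intro) auto
  next
    assume eq: "2 * u\<^sup>2 + 3 * v\<^sup>2 = int p"
    have "(2 * u\<^sup>2 - 3 * v\<^sup>2)\<^sup>2 + 6 * (2 * u * v)\<^sup>2 = (int p)\<^sup>2"
      unfolding eq[symmetric] by (simp add: power2_eq_square algebra_simps)
    then show ?thesis
      using P assms(2) \<open>u \<noteq> 0\<close> \<open>v \<noteq> 0\<close> by (intro that[of "2 * u\<^sup>2 - 3 * v\<^sup>2" "2 * u * v"] split_prime.intro) auto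
  qed
qed

lemma square_mult_mod_24:
  fixes p :: nat
  assumes "prime p" "p \<ge> 5"
  shows "p\<^sup>2 * N mod 24 = N mod 24"
  using prime_square_mod_24[OF assms] mod_mult_left_eq[of "p\<^sup>2" 24 N] by simp

text \<open>The identity \<open>3 * (2 * x\<^sup>2 + 3 * y\<^sup>2) = (3 * y)\<^sup>2 + 6 *
  x\<^sup>2\<close> makes 3y/x a square root of -6 modulo P as soon as x is invertible.\<close>

lemma inert_dvd:
  fixes P x y :: int
  assumes "prime P" "P > 3" "\<And>s. \<not> P dvd s\<^sup>2 + 6" "2 * x\<^sup>2 + 3 * y\<^sup>2 = N" "P dvd N"
  shows "P dvd x \<and> P dvd y"
proof -
  have "P dvd x"
  proof (rule ccontr)
    assume "\<not> P dvd x"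
    then have "coprime x P" using assms(1) prime_imp_coprime coprime_commute by blast
    then obtain z where "[x * z = 1] (mod P)" using cong_solve_coprime_int by blast
    then obtain k where z: "x * z = 1 + P * k"
      by (metis cong_iff_lin cong_sym)
    have "(3 * y * z)\<^sup>2 + 6 = 3 * (2 * x\<^sup>2 + 3 * y\<^sup>2) * z\<^sup>2 - 6 * ((x * z)\<^sup>2 - 1)"
      by (simp add: power2_eq_square algebra_simps)
    also have "\<dots> = 3 * N * z\<^sup>2 - P * (6 * k * (x * z + 1))"
      unfolding assms(4) by (simp add: z power2_eq_square algebra_simps)
    also have "P dvd \<dots>" using assms(5) by (intro dvd_diff dvd_mult2 dvd_mult[of P N 3] dvd_triv_left)
    finally show False using assms(3) by blast
  qed
  then show ?thesis using prime_dvd_form[OF assms(1,2,4,5)] by simp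
qed

lemma rep_count_inert:
  assumes p: "prime p" "p \<ge> 5" "\<And>s. \<not> int p dvd s\<^sup>2 + 6" and N: "N mod 24 = 5"
  shows "rep_count (p\<^sup>2 * N) = rep_count N"
    and "p dvd N \<Longrightarrow> \<not> p\<^sup>2 dvd N \<Longrightarrow> rep_count N = 0"
proof -
  have P: "prime (int p)" "int p > 3" using p by auto
  have "z \<in> reps 1 ((int p)\<^sup>2 * int N) \<longleftrightarrow> z \<in> (\<lambda>(x, y). (int p * x, int p * y)) ` reps 1 (int N)" for z
  proof
    assume z: "z \<in> reps 1 ((int p)\<^sup>2 * int N)"
    obtain x y where xy: "z = (x, y)" by (cases z)
    have "int p dvd x \<and> int p dvd y"
      by (rule inert_dvd[OF P p(3)]) (use z in \<open>auto simp: xy reps_def power2_eq_square\<close>)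
    then obtain a b where "z = (int p * a, int p * b)" by (auto simp: xy elim!: dvdE)
    then show "z \<in> (\<lambda>(x, y). (int p * x, int p * y)) ` reps 1 (int N)"
      using z reps_scale[OF P] by auto
  qed (use reps_scale[OF P] in auto)
  then have "reps 1 ((int p)\<^sup>2 * int N) = (\<lambda>(x, y). (int p * x, int p * y)) ` reps 1 (int N)" by blast
  moreover have "inj_on (\<lambda>(x, y). (int p * x, int p * y)) (reps 1 (int N))"
    using p by (auto simp: inj_on_def)
  ultimately have card: "card (reps 1 (int (p\<^sup>2 * N))) = card (reps 1 (int N))"
    by (simp add: card_image)
  show "rep_count (p\<^sup>2 * N) = rep_count N"
    using card card_reps_1[of "p\<^sup>2 * N"] card_reps_1[OF N] square_mult_mod_24[OF p(1,2), of N] N by linarith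
  show "rep_count N = 0" if "p dvd N" "\<not> p\<^sup>2 dvd N"
  proof -
    have "reps 1 (int N) = {}"
    proof (rule ccontr)
      assume "reps 1 (int N) \<noteq> {}"
      then obtain x y where eq: "2 * x\<^sup>2 + 3 * y\<^sup>2 = int N" by (auto simp: reps_def)
      have "int p dvd x \<and> int p dvd y"
        by (rule inert_dvd[OF P p(3) eq]) (use that in simp)
      then have "(int p)\<^sup>2 dvd 2 * x\<^sup>2 + 3 * y\<^sup>2" by (intro dvd_add dvd_mult dvd_power_same) auto
      then have "int (p\<^sup>2) dvd int N" unfolding eq of_nat_power .
      then show False using that by (simp only: int_dvd_int_iff)
    qed
    then show ?thesis using card_reps_1[OF N] by simp
  qed
qed

text \<open>For split p the relation at t = 1 involves the residues 1 + U V and 1 - U V. If 3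
  divides U V, both are 1 and contribute 4 A(N) in total. Otherwise one is 0 and the other -1,
  contributing a multiple of 4 plus 2 A(N). Halving leaves an even number or A(N) up to an even
  number, so c = 0 or c = 1.\<close>

lemma rep_count_hecke:
  fixes p :: nat
  assumes p: "prime p" "p \<ge> 5"
  obtains c :: nat where "\<And>N. N mod 24 = 5 \<Longrightarrow>
    even (rep_count (p\<^sup>2 * N) + (if p dvd N then 0 else rep_count N) +
      (if p\<^sup>2 dvd N then rep_count (N div p\<^sup>2) else 0) + c * rep_count N)"
proof (cases "\<exists>s. int p dvd s\<^sup>2 + 6")
  case True
  then obtain U V where "split_prime (int p) U V" using split_prime_exists[OF p] by blast
  then interpret split_prime "int p" U V .
  have cop: "2 * rep_count (p\<^sup>2 * N) = 2 * rep_count N + card (reps (1 + U * V) (int N)) + card (reps (1 - U * V) (int N))"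
    if "N mod 24 = 5" "\<not> p dvd N" for N
  proof -
    have "card (reps 1 (int (p\<^sup>2 * N))) = card (reps 1 (int N)) + card (reps (1 + U * V) (int N)) + card (reps (1 - U * V) (int N))"
      using hecke_coprime[of "int N" 1] that by simp
    then show ?thesis using that card_reps_1[of N] card_reps_1[of "p\<^sup>2 * N"] square_mult_mod_24[OF p] by simp
  qed
  have dvd: "2 * rep_count (p\<^sup>2 * N) + (if p\<^sup>2 dvd N then 2 * rep_count (N div p\<^sup>2) else 0) =
      card (reps (1 + U * V) (int N)) + card (reps (1 - U * V) (int N))"
    if "N mod 24 = 5" "p dvd N" for N
  proof -
    have 1: "card (reps 1 (int (p\<^sup>2 * N))) + (if p\<^sup>2 dvd N then card (reps 1 (int (N div p\<^sup>2))) else 0) =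
        card (reps (1 + U * V) (int N)) + card (reps (1 - U * V) (int N))"
    proof -
      have p2: "int (p\<^sup>2 * N) = (int p)\<^sup>2 * int N" by simp
      have dvd_iff: "p\<^sup>2 dvd N \<longleftrightarrow> (int p)\<^sup>2 dvd int N" by (metis int_dvd_int_iff of_nat_power)
      have div: "int (N div p\<^sup>2) = int N div (int p)\<^sup>2" by (simp add: zdiv_int)
      have "int p dvd int N" using that by simp
      from hecke_dvd[OF this, of 1] show ?thesis unfolding p2 dvd_iff div .
    qed
    have "N div p\<^sup>2 mod 24 = 5" if "p\<^sup>2 dvd N"
      using that \<open>N mod 24 = 5\<close> square_mult_mod_24[OF p, of "N div p\<^sup>2"] by simp
    then show ?thesis
      using 1 that card_reps_1[of "N div p\<^sup>2"] card_reps_1[of "p\<^sup>2 * N"] square_mult_mod_24[OF p]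
      by (auto split: if_splits)
  qed
  show ?thesis
  proof (cases "3 dvd U * V")
    case True
    have cong: "reps (1 + U * V) M = reps 1 M" "reps (1 - U * V) M = reps 1 M" for M
      using True by (auto intro!: reps_cong)
    show ?thesis
    proof (rule that[of 0])
      fix N :: nat assume N: "N mod 24 = 5"
      show "even (rep_count (p\<^sup>2 * N) + (if p dvd N then 0 else rep_count N) +
        (if p\<^sup>2 dvd N then rep_count (N div p\<^sup>2) else 0) + 0 * rep_count N)"
      proof (cases "p dvd N")
        case True
        then have "rep_count (p\<^sup>2 * N) + (if p\<^sup>2 dvd N then rep_count (N div p\<^sup>2) else 0) = 2 * rep_count N"
          using dvd[OF N] card_reps_1[OF N] by (simp add: cong split: if_splits)
        then show ?thesis using True by simp
      next
        case False
        then have "\<not> p\<^sup>2 dvd N" by (auto simp: power2_eq_square dest: dvd_mult_left)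
        moreover have "rep_count (p\<^sup>2 * N) = 3 * rep_count N"
          using cop[OF N False] card_reps_1[OF N] by (simp add: cong)
        ultimately show ?thesis using False by simp
      qed
    qed
  next
    case False
    have sum: "card (reps (1 + U * V) (int N)) + card (reps (1 - U * V) (int N)) = card (reps 0 (int N)) + 2 * rep_count N"
      if N: "N mod 24 = 5" for N
    proof -
      have "3 dvd (1 + U * V) - 0 \<and> 3 dvd (1 - U * V) - (- 1) \<or> 3 dvd (1 + U * V) - (- 1) \<and> 3 dvd (1 - U * V) - 0"
        using False by presburger
      then show ?thesis
        using reps_cong[of "1 + U * V"] reps_cong[of "1 - U * V"] card_reps_uminus[of 1 "int N"] card_reps_1[OF N]
        by (metis add.commute)
    qed
    show ?thesis
    proof (rule that[of 1])
      fix N :: nat assume N: "N mod 24 = 5"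
      have "int N mod 24 = 5" using N by presburger
      then obtain k where k: "card (reps 0 (int N)) = 4 * k" using dvd_card_reps_0 by (meson dvdE)
      show "even (rep_count (p\<^sup>2 * N) + (if p dvd N then 0 else rep_count N) +
        (if p\<^sup>2 dvd N then rep_count (N div p\<^sup>2) else 0) + 1 * rep_count N)"
      proof (cases "p dvd N")
        case True
        then have "rep_count (p\<^sup>2 * N) + (if p\<^sup>2 dvd N then rep_count (N div p\<^sup>2) else 0) = 2 * k + rep_count N"
          using dvd[OF N] by (simp add: sum[OF N] k split: if_splits)
        then show ?thesis using True by simp
      next
        case False
        then have "\<not> p\<^sup>2 dvd N" by (auto simp: power2_eq_square dest: dvd_mult_left)
        moreover have "2 * rep_count (p\<^sup>2 * N) = 4 * rep_count N + 4 * k"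
          using cop[OF N False] sum[OF N] k by linarith
        then have "rep_count (p\<^sup>2 * N) = 2 * (rep_count N + k)" by simp
        ultimately show ?thesis using False by simp
      qed
    qed
  qed
next
  case False
  then have inert: "\<And>s. \<not> int p dvd s\<^sup>2 + 6" by blast
  note inert = rep_count_inert[OF p inert]
  show ?thesis
  proof (rule that[of 0])
    fix N :: nat assume N: "N mod 24 = 5"
    show "even (rep_count (p\<^sup>2 * N) + (if p dvd N then 0 else rep_count N) +
      (if p\<^sup>2 dvd N then rep_count (N div p\<^sup>2) else 0) + 0 * rep_count N)"
    \<comment> \<open>A factor \<open>p\<^sup>2\<close> does not change the count, so the sum
      consists of two equal terms; if p divides N exactly once there is no solution at all.\<close>
    proof (cases "p\<^sup>2 dvd N")
      case True
      then obtain M where M: "N = p\<^sup>2 * M" ..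
      have "p dvd N" using M by (simp add: power2_eq_square)
      moreover have "M mod 24 = 5" using N M square_mult_mod_24[OF p] by simp
      ultimately show ?thesis using M inert(1)[OF N] inert(1)[of M] p by simp
    next
      case False
      then show ?thesis using inert[OF N] by auto
    qed
  qed
qed

section \<open>Theta series modulo 2\<close>

text \<open>Shanks' finite form of the pentagonal number theorem: only the term \<open>s = 0\<close> on the left
  contributes to the coefficients of order at most \<open>n\<close>. The proof telescopes the difference of
  consecutive sums.\<close>

lemma shanks_pentagonal:
  fixes q :: "'a :: comm_ring_1"
  shows "(\<Sum>s\<le>n. (- 1) ^ s * (\<Prod>k\<in>{s<..n}. 1 - q ^ k) * q ^ (s * n + s * (s + 1) div 2)) =
    1 + (\<Sum>k\<in>{1..n}. (- 1) ^ k * (q ^ (k * (3 * k - 1) div 2) + q ^ (k * (3 * k + 1) div 2)))"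
proof (induction n)
  case (Suc n)
  define R where "R s = (\<Prod>k\<in>{s<..n}. 1 - q ^ k)" for s
  define T where "T s = s * (s + 1) div 2" for s :: nat
  have T: "T (Suc s) = T s + s + 1" for s by (simp add: T_def)
  \<comment> \<open>For s at most n this is the s-th summand of the sum for n times 1 - q^s; the
    value 0 at s = 0 is that factor vanishing.\<close>
  define G where "G s = (case s of 0 \<Rightarrow> 0 | Suc r \<Rightarrow> (- 1) ^ s * R r * q ^ (s * n + T s))" for s
  have R_Suc: "(\<Prod>k\<in>{s<..Suc n}. 1 - q ^ k) = R s * (1 - q ^ Suc n)" if "s \<le> n" for s
  proof -
    have "{s<..Suc n} = insert (Suc n) {s<..n}" using that by auto
    then show ?thesis by (simp add: R_def)
  qed
  have R_step: "R s * (1 - q ^ s) = (case s of 0 \<Rightarrow> 0 | Suc r \<Rightarrow> R r)" if "s \<le> n" for s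
  proof (cases s)
    case (Suc r)
    have "{r<..n} = insert s {s<..n}" using Suc that by auto
    then show ?thesis by (simp add: R_def Suc)
  qed simp
  have step: "(- 1) ^ s * (R s * (1 - q ^ Suc n)) * q ^ (s * Suc n + T s) -
      (- 1) ^ s * R s * q ^ (s * n + T s) = G (Suc s) - G s" if "s \<le> n" for s
  proof -
    have "G s = (- 1) ^ s * (R s * (1 - q ^ s)) * q ^ (s * n + T s)"
      unfolding R_step[OF that] by (cases s) (simp_all add: G_def)
    moreover have "G (Suc s) = - ((- 1) ^ s * R s * q ^ (s * n + T s) * q ^ s * q ^ Suc n)"
      by (simp add: G_def T power_add algebra_simps)
    ultimately show ?thesis by (simp add: power_add algebra_simps)
  qed
  have "(\<Sum>s\<le>Suc n. (- 1) ^ s * (\<Prod>k\<in>{s<..Suc n}. 1 - q ^ k) * q ^ (s * Suc n + T s)) =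
      (\<Sum>s\<le>n. (- 1) ^ s * (R s * (1 - q ^ Suc n)) * q ^ (s * Suc n + T s)) +
      (- 1) ^ Suc n * q ^ (Suc n * Suc n + T (Suc n))"
    by (simp add: R_Suc)
  also have "(\<Sum>s\<le>n. (- 1) ^ s * (R s * (1 - q ^ Suc n)) * q ^ (s * Suc n + T s)) =
      (\<Sum>s\<le>n. (- 1) ^ s * R s * q ^ (s * n + T s)) + (\<Sum>s\<le>n. G (Suc s) - G s)"
    by (simp add: sum.distrib[symmetric] flip: step)
  also have "(\<Sum>s\<le>n. G (Suc s) - G s) = G (Suc n)"
    unfolding lessThan_Suc_atMost[symmetric] by (subst sum_lessThan_telescope) (simp add: G_def)
  also have "G (Suc n) = (- 1) ^ Suc n * q ^ (Suc n * n + T (Suc n))"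
    by (simp add: G_def R_def)
  also have "(\<Sum>s\<le>n. (- 1) ^ s * R s * q ^ (s * n + T s)) =
      1 + (\<Sum>k\<in>{1..n}. (- 1) ^ k * (q ^ (k * (3 * k - 1) div 2) + q ^ (k * (3 * k + 1) div 2)))"
    using Suc.IH by (simp only: R_def T_def)
  also have "Suc n * n + T (Suc n) = Suc n * (3 * Suc n - 1) div 2"
  proof -
    have "Suc n * (3 * Suc n - 1) = Suc n * (Suc n + 1) + Suc n * n * 2" by (simp add: algebra_simps)
    then show ?thesis by (simp add: T_def)
  qed
  also have "Suc n * Suc n + T (Suc n) = Suc n * (3 * Suc n + 1) div 2"
  proof -
    have "Suc n * (3 * Suc n + 1) = Suc n * (Suc n + 1) + Suc n * Suc n * 2" by (simp add: algebra_simps)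
    then show ?thesis by (simp add: T_def)
  qed
  finally show ?case unfolding T_def by (simp add: algebra_simps)
qed simp

text \<open>Shanks' finite form of Gauss' identity for \<open>\<Sum> q\<^bsup>k(k+1)/2\<^esup>\<close>, multiplied by its common
  denominator so that it holds in every commutative ring.\<close>

lemma shanks_triangular:
  fixes q :: "'a :: comm_ring_1"
  shows "(\<Sum>s<n. (\<Prod>k\<in>{s<..n}. 1 - q ^ (2 * k)) * (\<Prod>k\<in>{1..s}. 1 - q ^ (2 * k - 1)) * q ^ (s * (2 * n + 1))) =
    (\<Prod>k\<in>{1..n}. 1 - q ^ (2 * k - 1)) * (\<Sum>k<2 * n. q ^ (k * (k + 1) div 2))"
proof (induction n)
  case (Suc n)
  define Q where "Q s = (\<Prod>k\<in>{s<..n}. 1 - q ^ (2 * k)) * (\<Prod>k\<in>{1..s}. 1 - q ^ (2 * k - 1))" for s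
  define Ods where "Ods = (\<Prod>k\<in>{1..n}. 1 - q ^ (2 * k - 1))"
  define G where "G s = Q s * (1 - q ^ (2 * s)) * q ^ (s * (2 * n + 1))" for s
  have Q_Suc: "(\<Prod>k\<in>{s<..Suc n}. 1 - q ^ (2 * k)) * (\<Prod>k\<in>{1..s}. 1 - q ^ (2 * k - 1)) = (1 - q ^ (2 * Suc n)) * Q s"
    if "s \<le> n" for s
  proof -
    have "{s<..Suc n} = insert (Suc n) {s<..n}" using that by auto
    then show ?thesis by (simp add: Q_def mult.assoc)
  qed
  have Q_step: "Q s * (1 - q ^ (2 * s + 1)) = Q (Suc s) * (1 - q ^ (2 * Suc s))" if "s < n" for s
  proof -
    have "{s<..n} = insert (Suc s) {Suc s<..n}" using that by auto
    then show ?thesis by (simp add: Q_def algebra_simps)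
  qed
  \<comment> \<open>The sum for n is scaled by the new odd factor of the denominator before it is
    compared with the sum for n + 1; only after this scaling does the difference telescope.\<close>
  have step: "(1 - q ^ (2 * Suc n)) * Q s * q ^ (s * (2 * Suc n + 1)) =
      (1 - q ^ (2 * n + 1)) * (Q s * q ^ (s * (2 * n + 1))) + (G (Suc s) - G s)" if "s < n" for s
  proof -
    have G_Suc: "G (Suc s) = Q s * (1 - q ^ (2 * s + 1)) * q ^ (Suc s * (2 * n + 1))"
      unfolding Q_step[OF that] by (simp add: G_def)
    have exps: "q ^ (s * (2 * Suc n + 1)) = q ^ (s * (2 * n + 1)) * (q ^ s * q ^ s)"
      "q ^ (Suc s * (2 * n + 1)) = q ^ (s * (2 * n + 1)) * q ^ (2 * n + 1)"
      "q ^ (2 * s + 1) = q * (q ^ s * q ^ s)" "q ^ (2 * s) = q ^ s * q ^ s"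
      "q ^ (2 * Suc n) = q * q ^ (2 * n + 1)"
      by (simp_all add: power_add[symmetric] mult_2 mult_2_right algebra_simps flip: power_Suc)
    have alg: "(1 - q * w) * r * (e * (a * a)) =
        (1 - w) * (r * e) + (r * (1 - q * (a * a)) * (e * w) - r * (1 - a * a) * e)" for w r e a :: 'a
      by (simp add: algebra_simps)
    show ?thesis unfolding G_Suc unfolding G_def exps by (rule alg)
  qed
  have "(\<Sum>s<Suc n. (\<Prod>k\<in>{s<..Suc n}. 1 - q ^ (2 * k)) * (\<Prod>k\<in>{1..s}. 1 - q ^ (2 * k - 1)) * q ^ (s * (2 * Suc n + 1))) =
      (\<Sum>s<Suc n. (1 - q ^ (2 * Suc n)) * Q s * q ^ (s * (2 * Suc n + 1)))"
    by (rule sum.cong) (simp_all only: lessThan_iff less_Suc_eq_le Q_Suc)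
  also have "\<dots> = (\<Sum>s<n. (1 - q ^ (2 * Suc n)) * Q s * q ^ (s * (2 * Suc n + 1))) +
      (1 - q ^ (2 * Suc n)) * Ods * q ^ (n * (2 * Suc n + 1))"
    by (simp add: Q_def Ods_def)
  also have "(\<Sum>s<n. (1 - q ^ (2 * Suc n)) * Q s * q ^ (s * (2 * Suc n + 1))) =
      (1 - q ^ (2 * n + 1)) * (\<Sum>s<n. Q s * q ^ (s * (2 * n + 1))) + (\<Sum>s<n. G (Suc s) - G s)"
    by (simp only: sum_distrib_left sum.distrib[symmetric], rule sum.cong) (simp_all only: lessThan_iff step)
  also have "(\<Sum>s<n. G (Suc s) - G s) = Ods * (1 - q ^ (2 * n)) * q ^ (n * (2 * n + 1))"
    by (subst sum_lessThan_telescope) (simp add: G_def Q_def Ods_def)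
  also have "(\<Sum>s<n. Q s * q ^ (s * (2 * n + 1))) = Ods * (\<Sum>k<2 * n. q ^ (k * (k + 1) div 2))"
    using Suc.IH by (simp only: Q_def Ods_def)
  also have "(1 - q ^ (2 * n + 1)) * (Ods * (\<Sum>k<2 * n. q ^ (k * (k + 1) div 2))) +
      Ods * (1 - q ^ (2 * n)) * q ^ (n * (2 * n + 1)) + (1 - q ^ (2 * Suc n)) * Ods * q ^ (n * (2 * Suc n + 1)) =
      Ods * (1 - q ^ (2 * n + 1)) * ((\<Sum>k<2 * n. q ^ (k * (k + 1) div 2)) + q ^ (n * (2 * n + 1)) + q ^ ((n + 1) * (2 * n + 1)))"
  proof -
    have exps: "q ^ (2 * n + 1) = q * (q ^ n * q ^ n)" "q ^ (2 * n) = q ^ n * q ^ n"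
      "q ^ (2 * Suc n) = q * (q * (q ^ n * q ^ n))"
      "q ^ (n * (2 * Suc n + 1)) = q ^ (n * (2 * n + 1)) * (q ^ n * q ^ n)"
      "q ^ ((n + 1) * (2 * n + 1)) = q ^ (n * (2 * n + 1)) * (q * (q ^ n * q ^ n))"
      by (simp_all add: power_add[symmetric] mult_2 mult_2_right algebra_simps flip: power_Suc)
    have alg: "(1 - q * (a * a)) * (r * t) + r * (1 - a * a) * e + (1 - q * (q * (a * a))) * r * (e * (a * a)) =
        r * (1 - q * (a * a)) * (t + e + e * (q * (a * a)))" for r t a e :: 'a
      by (simp add: algebra_simps)
    show ?thesis unfolding exps by (rule alg)
  qed
  also have "n * (2 * n + 1) = 2 * n * (2 * n + 1) div 2" by simp
  also have "(n + 1) * (2 * n + 1) = Suc (2 * n) * (Suc (2 * n) + 1) div 2"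
  proof -
    have "Suc (2 * n) * (Suc (2 * n) + 1) = 2 * ((n + 1) * (2 * n + 1))" by (simp add: algebra_simps)
    then show ?thesis by simp
  qed
  also have "(\<Sum>k<2 * n. q ^ (k * (k + 1) div 2)) + q ^ (2 * n * (2 * n + 1) div 2) +
      q ^ (Suc (2 * n) * (Suc (2 * n) + 1) div 2) = (\<Sum>k<2 * Suc n. q ^ (k * (k + 1) div 2))"
    by simp
  also have "Ods * (1 - q ^ (2 * n + 1)) = (\<Prod>k\<in>{1..Suc n}. 1 - q ^ (2 * k - 1))"
    by (simp add: Ods_def)
  finally show ?case .
qed simp

section \<open>Counting series and reduction modulo 2\<close>

text \<open>An infinite fibre would be counted as 0, hence the finiteness hypotheses of the product
  rule.\<close>

definition weight_gf :: "'b set \<Rightarrow> ('b \<Rightarrow> nat) \<Rightarrow> 'a :: comm_semiring_1 fps" where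
  "weight_gf S w = Abs_fps (\<lambda>n. of_nat (card {x \<in> S. w x = n}))"

lemma weight_gf_nth [simp]: "fps_nth (weight_gf S w) n = of_nat (card {x \<in> S. w x = n})"
  by (simp add: weight_gf_def)

lemma weight_gf_mult:
  assumes "\<And>n. finite {x \<in> S. v x = n}" "\<And>n. finite {y \<in> T. w y = n}"
  shows "weight_gf S v * weight_gf T w = (weight_gf (S \<times> T) (\<lambda>(x, y). v x + w y) :: 'a :: comm_semiring_1 fps)"
proof (rule fps_ext)
  fix n
  have "{z \<in> S \<times> T. (case z of (x, y) \<Rightarrow> v x + w y) = n} =
      (\<Union>i\<in>{0..n}. {x \<in> S. v x = i} \<times> {y \<in> T. w y = n - i})"
    by auto
  then have "card {z \<in> S \<times> T. (case z of (x, y) \<Rightarrow> v x + w y) = n} =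
      (\<Sum>i=0..n. card ({x \<in> S. v x = i} \<times> {y \<in> T. w y = n - i}))"
    by (simp only:, subst card_UN_disjoint) (use assms in auto)
  then show "fps_nth (weight_gf S v * weight_gf T w) n = fps_nth (weight_gf (S \<times> T) (\<lambda>(x, y). v x + w y) :: 'a fps) n"
    by (simp add: fps_mult_nth card_cartesian_product)
qed

lemma weight_gf_finite:
  assumes "finite S"
  shows "weight_gf S w = (\<Sum>x\<in>S. fps_X ^ w x :: 'a :: comm_semiring_1 fps)"
proof (rule fps_ext)
  fix n
  have "fps_nth (\<Sum>x\<in>S. fps_X ^ w x :: 'a fps) n = (\<Sum>x\<in>S. if w x = n then 1 else 0)"
    by (simp add: fps_sum_nth eq_commute)
  also have "\<dots> = of_nat (card {x \<in> S. w x = n})"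
    using assms by (simp add: sum.If_cases Int_def)
  finally show "fps_nth (weight_gf S w) n = fps_nth (\<Sum>x\<in>S. fps_X ^ w x :: 'a fps) n" by simp
qed

text \<open>Over the field \<open>bit\<close> a congruence modulo 2 is an equation, signs disappear,
  and nonzero series can be cancelled.\<close>

definition fps_mod2 :: "int fps \<Rightarrow> bit fps" where
  "fps_mod2 f = Abs_fps (\<lambda>n. of_int (fps_nth f n))"

lemma fps_mod2_nth [simp]: "fps_nth (fps_mod2 f) n = of_int (fps_nth f n)"
  by (simp add: fps_mod2_def)

lemma fps_mod2_mult: "fps_mod2 (f * g) = fps_mod2 f * fps_mod2 g"
  by (rule fps_ext) (simp add: fps_mult_nth)

lemma fps_mod2_one: "fps_mod2 1 = 1"
  by (rule fps_ext) simp

lemma fps_mod2_power: "fps_mod2 (f ^ n) = fps_mod2 f ^ n"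
  by (induction n) (simp_all add: fps_mod2_one fps_mod2_mult)

lemma fps_mod2_prod: "fps_mod2 (\<Prod>x\<in>A. f x) = (\<Prod>x\<in>A. fps_mod2 (f x))"
  by (induction A rule: infinite_finite_induct) (simp_all add: fps_mod2_one fps_mod2_mult)

lemma fps_mod2_one_minus_X_power: "fps_mod2 (1 - fps_X ^ k) = 1 - fps_X ^ k"
  by (rule fps_ext) simp

definition euler2 :: "nat \<Rightarrow> bit fps" where
  "euler2 i = fps_mod2 (euler_f i)"

definition qpoch :: "nat \<Rightarrow> nat \<Rightarrow> bit fps" where
  "qpoch i n = (\<Prod>k\<in>{0<..n}. 1 - (fps_X ^ i) ^ k)"

lemma qpoch_Suc: "qpoch i (Suc n) = qpoch i n * (1 - (fps_X ^ i) ^ Suc n)"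
proof -
  have "prod f {0<..Suc n} = prod f {0<..n} * f (Suc n)" for f :: "nat \<Rightarrow> bit fps"
    using atLeastSucAtMost_greaterThanAtMost[of 0] by (metis One_nat_def prod.nat_ivl_Suc' mult.commute le_add1 plus_1_eq_Suc)
  then show ?thesis by (simp only: qpoch_def)
qed

text \<open>The omitted factors differ from 1 only in degrees above n. All identities between
  infinite products below are checked coefficientwise on such truncations.\<close>

lemma euler2_nth:
  assumes "i > 0" "k \<le> n"
  shows "fps_nth (euler2 i) k = fps_nth (qpoch i n) k"
proof -
  let ?P = "\<lambda>N. \<Prod>m<N. 1 - fps_X ^ (i * Suc m) :: int fps"
  have "?P \<longlonglongrightarrow> euler_f i"
    using has_prod_imp_tendsto'[OF euler_f_has_prod[OF assms(1)]] .
  then have "\<forall>\<^sub>F N in sequentially. fps_nth (?P N) k = fps_nth (euler_f i) k"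
    by (simp only: tendsto_fps_iff)
  then obtain N0 where N0: "\<And>N. N \<ge> N0 \<Longrightarrow> fps_nth (?P N) k = fps_nth (euler_f i) k"
    by (auto simp: eventually_sequentially)
  have "fps_nth (?P n) k = fps_nth (?P (max N0 k)) k"
    using assms by (intro euler_f_partial_nth) auto
  also have "\<dots> = fps_nth (euler_f i) k" by (rule N0) simp
  finally have "fps_nth (euler2 i) k = fps_nth (fps_mod2 (?P n)) k"
    by (simp add: euler2_def)
  also have "fps_mod2 (?P n) = (\<Prod>m<n. 1 - fps_X ^ (i * Suc m))"
    by (simp only: fps_mod2_prod fps_mod2_one_minus_X_power)
  also have "\<dots> = qpoch i n"
    by (induction n) (simp_all only: qpoch_Suc prod.lessThan_Suc power_mult, simp add: qpoch_def)
  finally show ?thesis .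
qed

lemma euler2_nth_0: "i > 0 \<Longrightarrow> fps_nth (euler2 i) 0 = 1"
  using euler2_nth[of i 0 0] by (simp add: qpoch_def)

lemma euler2_nonzero: "i > 0 \<Longrightarrow> euler2 i \<noteq> 0"
  using euler2_nth_0[of i] by auto

lemma fps_mult_nth_cong:
  assumes "\<And>k. k \<le> n \<Longrightarrow> fps_nth f k = fps_nth f' k" "\<And>k. k \<le> n \<Longrightarrow> fps_nth g k = fps_nth g' k"
  shows "fps_nth (f * g) n = fps_nth (f' * g') n"
  unfolding fps_mult_nth by (rule sum.cong) (use assms in auto)

lemma bit_fps_add_self: "f + f = (0 :: bit fps)"
  by (rule fps_ext) simp

lemma bit_fps_uminus: "- f = (f :: bit fps)"
  by (rule fps_ext) simp

lemma bit_fps_minus_one_power: "(- 1 :: bit fps) ^ n = 1"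
  by (simp add: bit_fps_uminus)

lemma qpoch_square: "qpoch i n ^ 2 = qpoch (2 * i) n"
proof -
  have sq: "(1 - f) ^ 2 = 1 - f ^ 2" for f :: "bit fps"
  proof -
    have "(1 - f) ^ 2 = 1 - (f + f) + f ^ 2" by (simp add: power2_eq_square algebra_simps)
    also have "\<dots> = 1 - f ^ 2" using bit_fps_uminus[of "f ^ 2"] by (simp add: bit_fps_add_self)
    finally show ?thesis .
  qed
  show ?thesis
    unfolding qpoch_def prod_power_distrib sq by (simp only: power_mult[symmetric] ac_simps)
qed

lemma euler2_square:
  assumes "i > 0"
  shows "euler2 i ^ 2 = euler2 (2 * i)"
proof (rule fps_ext)
  fix n
  have "fps_nth (euler2 i ^ 2) n = fps_nth (qpoch i n ^ 2) n"
    unfolding power2_eq_square by (intro fps_mult_nth_cong euler2_nth assms)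
  also have "\<dots> = fps_nth (euler2 (2 * i)) n"
    unfolding qpoch_square using assms by (subst euler2_nth) auto
  finally show "fps_nth (euler2 i ^ 2) n = fps_nth (euler2 (2 * i)) n" .
qed

text \<open>The numbers k(3k - 1)/2 and k(3k + 1)/2 are \<open>(x\<^sup>2 - 1) div 24\<close> for x
  = 6k - 1 and x = 6k + 1; these x, together with x = 1, exhaust the numbers prime to 6.\<close>

lemma pentagonal_sum:
  fixes q :: "'a :: comm_semiring_1"
  shows "1 + (\<Sum>k\<in>{1..n}. q ^ (k * (3 * k - 1) div 2) + q ^ (k * (3 * k + 1) div 2)) =
    (\<Sum>x | coprime x 6 \<and> x \<le> 6 * n + 1. q ^ ((x\<^sup>2 - 1) div 24))"
proof (induction n)
  case 0
  have "{x :: nat. coprime x 6 \<and> x \<le> 6 * 0 + 1} = {1}" by (auto simp: le_Suc_eq)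
  then show ?case by simp
next
  case (Suc n)
  have "coprime x 6 \<and> x \<le> 6 * Suc n + 1 \<longleftrightarrow>
      x = 6 * n + 5 \<or> x = 6 * n + 7 \<or> (coprime x 6 \<and> x \<le> 6 * n + 1)" for x
    unfolding coprime_6_iff_nat by presburger
  then have set: "{x :: nat. coprime x 6 \<and> x \<le> 6 * Suc n + 1} =
      insert (6 * n + 5) (insert (6 * n + 7) {x. coprime x 6 \<and> x \<le> 6 * n + 1})"
    by auto
  have fin: "finite {x :: nat. coprime x 6 \<and> x \<le> 6 * n + 1}" by (rule finite_subset[of _ "{..6 * n + 1}"]) auto
  have "(6 * n + 5)\<^sup>2 - 1 = 24 * (Suc n * (3 * Suc n - 1) div 2)"
  proof -
    have "even (Suc n * (3 * Suc n - 1))" by simp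
    then obtain m where m: "Suc n * (3 * Suc n - 1) = 2 * m" ..
    have "(6 * n + 5)\<^sup>2 - 1 = 12 * (Suc n * (3 * Suc n - 1))"
      by (simp add: power2_eq_square algebra_simps)
    then show ?thesis unfolding m by simp
  qed
  moreover have "(6 * n + 7)\<^sup>2 - 1 = 24 * (Suc n * (3 * Suc n + 1) div 2)"
  proof -
    have "even (Suc n * (3 * Suc n + 1))" by simp
    then obtain m where m: "Suc n * (3 * Suc n + 1) = 2 * m" ..
    have "(6 * n + 7)\<^sup>2 - 1 = 12 * (Suc n * (3 * Suc n + 1))"
      by (simp add: power2_eq_square algebra_simps)
    then show ?thesis unfolding m by simp
  qed
  ultimately have div: "((6 * n + 5)\<^sup>2 - 1) div 24 = Suc n * (3 * Suc n - 1) div 2"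
    "((6 * n + 7)\<^sup>2 - 1) div 24 = Suc n * (3 * Suc n + 1) div 2"
    by simp_all
  have "(\<Sum>x | coprime x 6 \<and> x \<le> 6 * Suc n + 1. q ^ ((x\<^sup>2 - 1) div 24)) =
      q ^ (((6 * n + 5)\<^sup>2 - 1) div 24) + (q ^ (((6 * n + 7)\<^sup>2 - 1) div 24) +
       (\<Sum>x | coprime x 6 \<and> x \<le> 6 * n + 1. q ^ ((x\<^sup>2 - 1) div 24)))"
    unfolding set using fin by simp
  moreover have "(\<Sum>k\<in>{1..Suc n}. f k) = (\<Sum>k\<in>{1..n}. f k) + f (Suc n)" for f :: "nat \<Rightarrow> 'a"
    by simp
  ultimately show ?case
    unfolding div Suc.IH[symmetric] by (simp only: ac_simps)
qed

lemma euler2_pentagonal: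
  assumes "i > 0"
  shows "euler2 i = weight_gf {x. coprime x 6} (\<lambda>x. i * ((x\<^sup>2 - 1) div 24))"
proof (rule fps_ext)
  fix m :: nat
  \<comment> \<open>With n > m every term with s > 0 in the finite identity has order at least n, so
    it does not reach the coefficient of degree m.\<close>
  define n where "n = Suc m"
  define q :: "bit fps" where "q = fps_X ^ i"
  have "(\<Sum>s\<le>n. (- 1) ^ s * (\<Prod>k\<in>{s<..n}. 1 - q ^ k) * q ^ (s * n + s * (s + 1) div 2)) =
      (\<Sum>x | coprime x 6 \<and> x \<le> 6 * n + 1. q ^ ((x\<^sup>2 - 1) div 24))"
    using shanks_pentagonal[where q = q and n = n] by (simp only: bit_fps_minus_one_power mult_1_left pentagonal_sum)
  moreover have "(\<Sum>s\<le>n. (- 1) ^ s * (\<Prod>k\<in>{s<..n}. 1 - q ^ k) * q ^ (s * n + s * (s + 1) div 2)) =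
      qpoch i n + (\<Sum>s\<in>{1..n}. (\<Prod>k\<in>{s<..n}. 1 - q ^ k) * q ^ (s * n + s * (s + 1) div 2))"
  proof -
    have "{..n} = insert 0 {1..n}" by auto
    then show ?thesis by (simp add: bit_fps_minus_one_power q_def qpoch_def)
  qed
  moreover have "fps_nth (\<Sum>s\<in>{1..n}. (\<Prod>k\<in>{s<..n}. 1 - q ^ k) * q ^ (s * n + s * (s + 1) div 2)) m = 0"
    unfolding fps_sum_nth
  proof (rule sum.neutral, rule ballI)
    fix s assume "s \<in> {1..n}"
    then have "n \<le> s * n" by simp
    also have "\<dots> \<le> s * n + s * (s + 1) div 2" by (rule le_add1)
    also have "\<dots> \<le> i * (s * n + s * (s + 1) div 2)" using assms by simp
    finally have "m < i * (s * n + s * (s + 1) div 2)" by (simp add: n_def)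
    then show "fps_nth ((\<Prod>k\<in>{s<..n}. 1 - q ^ k) * q ^ (s * n + s * (s + 1) div 2)) m = 0"
      unfolding q_def power_mult[symmetric] by (simp only: fps_X_power_mult_right_nth if_True)
  qed
  ultimately have "fps_nth (euler2 i) m = fps_nth (\<Sum>x | coprime x 6 \<and> x \<le> 6 * n + 1. q ^ ((x\<^sup>2 - 1) div 24)) m"
    using euler2_nth[OF assms, of m n] by (simp add: n_def)
  also have "(\<Sum>x | coprime x 6 \<and> x \<le> 6 * n + 1. q ^ ((x\<^sup>2 - 1) div 24)) =
      weight_gf {x. coprime x 6 \<and> x \<le> 6 * n + 1} (\<lambda>x. i * ((x\<^sup>2 - 1) div 24))"
    by (subst weight_gf_finite) (auto simp: q_def power_mult intro: finite_subset[of _ "{..6 * n + 1}"])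
  also have "fps_nth \<dots> m = of_nat (card {x. coprime x 6 \<and> i * ((x\<^sup>2 - 1) div 24) = m})"
  proof -
    have "x \<le> 6 * n + 1" if "i * ((x\<^sup>2 - 1) div 24) = m" for x :: nat
    proof (rule ccontr)
      assume "\<not> x \<le> 6 * n + 1"
      then have "(6 * n + 2)\<^sup>2 \<le> x\<^sup>2" by (intro power_mono) auto
      then have "24 * n \<le> x\<^sup>2 - 1" by (simp add: power2_eq_square algebra_simps)
      then have "n \<le> (x\<^sup>2 - 1) div 24" by simp
      also have "\<dots> \<le> i * ((x\<^sup>2 - 1) div 24)" using assms by simp
      finally show False using that by (simp add: n_def)
    qed
    then have "{x \<in> {x. coprime x 6 \<and> x \<le> 6 * n + 1}. i * ((x\<^sup>2 - 1) div 24) = m} =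
        {x. coprime x 6 \<and> i * ((x\<^sup>2 - 1) div 24) = m}" by blast
    then show ?thesis by simp
  qed
  finally show "fps_nth (euler2 i) m = fps_nth (weight_gf {x. coprime x 6} (\<lambda>x. i * ((x\<^sup>2 - 1) div 24))) m"
    by simp
qed

lemma qpoch_odd_even:
  "(\<Prod>k\<in>{1..n}. 1 - fps_X ^ (2 * k - 1)) * qpoch 2 n = qpoch 1 (2 * n)"
proof (induction n)
  case (Suc n)
  have X: "(fps_X ^ 2) ^ Suc n = (fps_X ^ Suc (Suc (2 * n)) :: bit fps)"
    by (simp only: power_mult[symmetric] mult_Suc_right add_2_eq_Suc)
  have step: "(\<Prod>k\<in>{1..Suc n}. 1 - fps_X ^ (2 * k - 1)) =
      (\<Prod>k\<in>{1..n}. 1 - fps_X ^ (2 * k - 1)) * (1 - fps_X ^ Suc (2 * n) :: bit fps)"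
    by (simp add: mult.commute)
  have "qpoch 1 (2 * Suc n) = qpoch 1 (2 * n) * (1 - fps_X ^ Suc (2 * n)) * (1 - fps_X ^ Suc (Suc (2 * n)))"
    by (simp only: qpoch_Suc power_one_right mult_Suc_right add_2_eq_Suc)
  then show ?case
    unfolding Suc.IH[symmetric] step qpoch_Suc[of 2] X by (simp only: ac_simps)
qed (simp add: qpoch_def)

text \<open>Gauss' identity is \<open>f_2\<^sup>2\<close> = f_1 psi with psi the triangular series.
  Modulo 2 the left side is the fourth power of f_1, and one factor cancels. This is also Jacobi's
  formula for the cube, whose coefficients 2k + 1 are all odd.\<close>

lemma euler2_cube: "euler2 1 ^ 3 = weight_gf UNIV (\<lambda>k. k * (k + 1) div 2)" (is "_ = ?psi")
proof -
  have "euler2 2 * euler2 2 = euler2 1 * ?psi"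
  proof (rule fps_ext)
    fix n :: nat
    define q :: "bit fps" where "q = fps_X"
    define Ods where "Ods = (\<Prod>k\<in>{1..n}. 1 - q ^ (2 * k - 1))"
    define T where "T = (\<Sum>k<2 * n. q ^ (k * (k + 1) div 2))"
    show "fps_nth (euler2 2 * euler2 2) n = fps_nth (euler2 1 * ?psi) n"
    \<comment> \<open>The sum in \<open>shanks_triangular\<close> runs over s < n, so for n = 0 it
      lacks the decisive term s = 0.\<close>
    proof (cases "n = 0")
      case True
      have "k * (k + 1) div 2 = 0 \<longleftrightarrow> k = 0" for k :: nat
        by (cases k) auto
      then have "card {k :: nat. k * (k + 1) div 2 = 0} = 1" by (simp only: singleton_conv is_singleton_altdef[symmetric]) simp
      then show ?thesis by (simp add: True euler2_nth_0)
    next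
      case False
      have s: "(\<Sum>s<n. (\<Prod>k\<in>{s<..n}. 1 - q ^ (2 * k)) * (\<Prod>k\<in>{1..s}. 1 - q ^ (2 * k - 1)) * q ^ (s * (2 * n + 1))) = Ods * T"
        unfolding Ods_def T_def by (rule shanks_triangular)
      \<comment> \<open>Terms with s > 0 have order at least 2n + 1; the term s = 0 is
        \<open>qpoch 2 n\<close>.\<close>
      have e: "fps_nth (qpoch 2 n) m = fps_nth (Ods * T) m" if "m \<le> n" for m
      proof -
        have "fps_nth (Ods * T) m = (\<Sum>s<n. fps_nth ((\<Prod>k\<in>{s<..n}. 1 - q ^ (2 * k)) * (\<Prod>k\<in>{1..s}. 1 - q ^ (2 * k - 1)) * q ^ (s * (2 * n + 1))) m)"
          by (simp only: s[symmetric] fps_sum_nth)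
        also have "\<dots> = (\<Sum>s\<in>{0}. fps_nth ((\<Prod>k\<in>{s<..n}. 1 - q ^ (2 * k)) * (\<Prod>k\<in>{1..s}. 1 - q ^ (2 * k - 1)) * q ^ (s * (2 * n + 1))) m)"
        proof (rule sum.mono_neutral_right)
          show "\<forall>s\<in>{..<n} - {0}. fps_nth ((\<Prod>k\<in>{s<..n}. 1 - q ^ (2 * k)) * (\<Prod>k\<in>{1..s}. 1 - q ^ (2 * k - 1)) * q ^ (s * (2 * n + 1))) m = 0"
          proof
            fix s assume "s \<in> {..<n} - {0}"
            then have "1 * (2 * n + 1) \<le> s * (2 * n + 1)" by (intro mult_right_mono) auto
            moreover have "m < 1 * (2 * n + 1)" using that by simp
            ultimately have "m < s * (2 * n + 1)" by (rule less_le_trans[rotated])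
            then show "fps_nth ((\<Prod>k\<in>{s<..n}. 1 - q ^ (2 * k)) * (\<Prod>k\<in>{1..s}. 1 - q ^ (2 * k - 1)) * q ^ (s * (2 * n + 1))) m = 0"
              unfolding q_def by (simp only: fps_X_power_mult_right_nth if_True)
          qed
        qed (use False in auto)
        also have "\<dots> = fps_nth (qpoch 2 n) m" by (simp add: q_def qpoch_def flip: power_mult)
        finally show ?thesis ..
      qed
      have psi: "fps_nth ?psi m = fps_nth T m" if "m \<le> n" for m
      proof -
        have k: "k < 2 * n" if "k * (k + 1) div 2 = m" for k
        proof (rule ccontr)
          assume "\<not> k < 2 * n"
          then have "2 * n * (2 * n + 1) \<le> k * (k + 1)" by (intro mult_mono) auto
          then have "2 * n * (2 * n + 1) div 2 \<le> m" unfolding that[symmetric] by (rule div_le_mono)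
          moreover have "2 * n * (2 * n + 1) div 2 = n * (2 * n + 1)" by simp
          moreover have "n * 1 < n * (2 * n + 1)" using False by (intro mult_strict_left_mono) auto
          ultimately show False using \<open>m \<le> n\<close> by linarith
        qed
        have "T = weight_gf {..<2 * n} (\<lambda>k. k * (k + 1) div 2)"
          by (simp add: T_def q_def weight_gf_finite)
        moreover have "{k \<in> {..<2 * n}. k * (k + 1) div 2 = m} = {k. k * (k + 1) div 2 = m}"
          using k by blast
        ultimately show ?thesis by simp
      qed
      have "fps_nth (euler2 2 * euler2 2) n = fps_nth (qpoch 2 n * (Ods * T)) n"
        using e by (intro fps_mult_nth_cong) (simp_all add: euler2_nth[of 2 _ n])
      also have "qpoch 2 n * (Ods * T) = qpoch 1 (2 * n) * T"
        unfolding qpoch_odd_even[symmetric] Ods_def q_def by (simp only: ac_simps)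
      also have "fps_nth \<dots> n = fps_nth (euler2 1 * ?psi) n"
        by (intro fps_mult_nth_cong) (simp_all only: psi euler2_nth[of 1 _ "2 * n"] zero_less_one)
      finally show ?thesis .
    qed
  qed
  moreover have "euler2 2 = euler2 1 ^ 2" using euler2_square[of 1] by simp
  ultimately have "euler2 1 * euler2 1 ^ 3 = euler2 1 * ?psi" by (simp add: power2_eq_square power3_eq_cube mult.assoc)
  then show ?thesis using euler2_nonzero[of 1] by simp
qed

section \<open>Regular partitions modulo 2\<close>

text \<open>Multiplying by 1 - q^a subtracts the partitions that contain a, since these arise by
  adding one copy of a to a partition of n - a.\<close>

lemma partition_gf:
  assumes "finite A" "0 \<notin> A"
  shows "weight_gf {M. set_mset M \<subseteq> A} sum_mset * (\<Prod>a\<in>A. 1 - fps_X ^ a) = (1 :: 'a :: comm_ring_1 fps)"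
  using assms
proof (induction A)
  case empty
  have "{M :: nat multiset. M = {#} \<and> sum_mset M = n} = (if n = 0 then {{#}} else {})" for n by auto
  then have "weight_gf {M. set_mset M \<subseteq> {}} sum_mset = (1 :: 'a fps)"
    by (intro fps_ext) simp
  then show ?case by simp
next
  case (insert a A)
  let ?P = "\<lambda>A n. {M. set_mset M \<subseteq> A \<and> sum_mset M = (n :: nat)}"
  \<comment> \<open>For l = k = 0 regularity merely says that the parts are nonzero, as 0 divides
    only 0.\<close>
  have fin: "finite (?P B n)" if "0 \<notin> B" for B n
    by (rule finite_subset[OF _ finite_regular_partitions[of 0 0 n]])
      (use that in \<open>auto simp: regular_partitions_def intro!: Nat.gr0I\<close>)
  have "weight_gf {M. set_mset M \<subseteq> insert a A} sum_mset * (1 - fps_X ^ a) =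
      (weight_gf {M. set_mset M \<subseteq> A} sum_mset :: 'a fps)"
  proof (rule fps_ext)
    fix n
    show "fps_nth (weight_gf {M. set_mset M \<subseteq> insert a A} sum_mset * (1 - fps_X ^ a)) n =
        fps_nth (weight_gf {M. set_mset M \<subseteq> A} sum_mset :: 'a fps) n"
    proof (cases "a \<le> n")
      case True
      have "?P (insert a A) n = ?P A n \<union> add_mset a ` ?P (insert a A) (n - a)"
      proof (intro equalityI subsetI)
        fix M assume M: "M \<in> ?P (insert a A) n"
        show "M \<in> ?P A n \<union> add_mset a ` ?P (insert a A) (n - a)"
        proof (cases "a \<in># M")
          case True
          then obtain M' where M': "M = add_mset a M'" by (metis mset_add)
          have "M' \<in> ?P (insert a A) (n - a)" using M by (auto simp: M')
          then show ?thesis unfolding M' by (intro UnI2 imageI)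
        next
          case False
          then have "set_mset M \<subseteq> A" using M by blast
          then show ?thesis using M by simp
        qed
      next
        fix M assume "M \<in> ?P A n \<union> add_mset a ` ?P (insert a A) (n - a)"
        then show "M \<in> ?P (insert a A) n"
        proof
          assume "M \<in> add_mset a ` ?P (insert a A) (n - a)"
          then obtain M' where "M = add_mset a M'" "M' \<in> ?P (insert a A) (n - a)" ..
          then show ?thesis using True by simp
        qed blast
      qed
      moreover have "?P A n \<inter> add_mset a ` ?P (insert a A) (n - a) = {}"
      proof -
        have "add_mset a M \<notin> ?P A n" for M using insert.hyps(2) by simp
        then show ?thesis by blast
      qed
      moreover have "finite (?P A n)" "finite (add_mset a ` ?P (insert a A) (n - a))"
        using insert.prems by (auto intro!: fin finite_imageI)
      ultimately have "card (?P (insert a A) n) = card (?P A n) + card (add_mset a ` ?P (insert a A) (n - a))"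
        by (simp only: card_Un_disjoint)
      also have "card (add_mset a ` ?P (insert a A) (n - a)) = card (?P (insert a A) (n - a))"
        by (rule card_image) (simp add: inj_on_def)
      finally show ?thesis using True by (simp add: right_diff_distrib fps_X_power_mult_right_nth)
    next
      case False
      have "a \<notin># M" if "sum_mset M = n" for M
        using that False by (auto dest!: multi_member_split)
      then have "?P (insert a A) n = ?P A n" by blast
      then show ?thesis using False by (simp add: right_diff_distrib fps_X_power_mult_right_nth)
    qed
  qed
  then show ?case using insert by (simp add: mult.assoc[symmetric])
qed

lemma qpoch_multiples:
  assumes "i > 0"
  shows "qpoch i n = (\<Prod>x | 0 < x \<and> x \<le> i * n \<and> i dvd x. 1 - fps_X ^ x)"
  unfolding qpoch_def power_mult[symmetric]
  by (rule prod.reindex_bij_witness[of _ "\<lambda>x. x div i" "\<lambda>k. i * k"]) (use assms in \<open>auto simp: dvd_def\<close>)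

lemma b_reg_gf:
  assumes "coprime l k" "l > 0" "k > 0"
  shows "Abs_fps (\<lambda>n. of_nat (b_reg l k n)) * (euler2 1 * euler2 (l * k)) = euler2 l * euler2 k"
proof (rule fps_ext)
  fix n
  \<comment> \<open>As l, k and l k all divide N, the truncations below run over exactly the
    multiples of 1, l, k and l k up to the common bound N, and inclusion-exclusion applies without
    remainder terms.\<close>
  define N where "N = l * k * n"
  define A where "A = {x. 0 < x \<and> x \<le> N \<and> \<not> l dvd x \<and> \<not> k dvd x}"
  define M where "M i = {x. 0 < x \<and> x \<le> N \<and> i dvd x}" for i
  define F :: "nat set \<Rightarrow> bit fps" where "F S = (\<Prod>x\<in>S. 1 - fps_X ^ x)" for S
  define W :: "bit fps" where "W = weight_gf {M. set_mset M \<subseteq> A} sum_mset"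
  have nN: "n \<le> N" "n \<le> l * n" "n \<le> k * n" using assms(2,3) by (auto simp: N_def)
  note le = order.trans[OF _ nN(1)] order.trans[OF _ nN(2)] order.trans[OF _ nN(3)]
  have fin: "finite A" "finite (M i)" for i by (auto simp: A_def M_def)
  have W: "W * F A = 1"
    unfolding W_def F_def by (rule partition_gf[OF fin(1)]) (simp add: A_def)
  have gf: "fps_nth (Abs_fps (\<lambda>n. of_nat (b_reg l k n))) m = fps_nth W m" if "m \<le> n" for m
  proof -
    have "x \<le> sum_mset M" if "x \<in># M" for x and M :: "nat multiset"
      using that by (auto dest!: multi_member_split)
    then have "regular_partitions l k m = {M. set_mset M \<subseteq> A \<and> sum_mset M = m}"
      using that nN(1) by (fastforce simp: regular_partitions_def A_def)
    then show ?thesis by (simp add: W_def b_reg_def)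
  qed
  have M: "M 1 = A \<union> (M l \<union> M k)" "A \<inter> (M l \<union> M k) = {}" "M l \<inter> M k = M (l * k)"
    using assms(1) by (auto simp: A_def M_def intro: divides_mult dvd_mult_left dvd_mult_right)
  have q: "qpoch 1 N = F (M 1)" "qpoch (l * k) n = F (M (l * k))" "qpoch l (k * n) = F (M l)" "qpoch k (l * n) = F (M k)"
    using assms(2,3) by (simp_all add: qpoch_multiples F_def M_def N_def mult.assoc mult.left_commute[of k l])
  have "F (M 1) = F A * F (M l \<union> M k)"
    unfolding M(1) F_def by (rule prod.union_disjoint) (use fin M(2) in auto)
  moreover have "F (M l \<union> M k) * F (M (l * k)) = F (M l) * F (M k)"
    unfolding M(3)[symmetric] F_def by (rule prod.union_inter) (use fin in auto)
  ultimately have "W * (qpoch 1 N * qpoch (l * k) n) = W * F A * (qpoch l (k * n) * qpoch k (l * n))"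
    unfolding q by (simp only: mult.assoc)
  then have eq: "W * (qpoch 1 N * qpoch (l * k) n) = qpoch l (k * n) * qpoch k (l * n)" by (simp add: W)
  have "fps_nth (Abs_fps (\<lambda>n. of_nat (b_reg l k n)) * (euler2 1 * euler2 (l * k))) n =
      fps_nth (W * (qpoch 1 N * qpoch (l * k) n)) n"
    using assms(2,3) by (intro fps_mult_nth_cong gf euler2_nth) (auto intro: le)
  also have "\<dots> = fps_nth (euler2 l * euler2 k) n"
    unfolding eq using assms(2,3) by (intro fps_mult_nth_cong euler2_nth[symmetric]) (auto intro: le)
  finally show "fps_nth (Abs_fps (\<lambda>n. of_nat (b_reg l k n)) * (euler2 1 * euler2 (l * k))) n = fps_nth (euler2 l * euler2 k) n" .
qed

text \<open>The rotation \<open>(u, v) \<mapsto> (u + 2 v, u - 2 v)\<close> doubles \<open>u\<^sup>2 + 4 v\<^sup>2\<close>; for \<open>u\<close>, \<open>v\<close> prime to 3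
  exactly one of \<open>u \<plusminus> 2 v\<close> is divisible by 3.\<close>

lemma card_rotated_forms:
  fixes e :: nat
  assumes "odd e"
  shows "card {(u, v). coprime u 6 \<and> coprime v 6 \<and> u\<^sup>2 + 4 * v\<^sup>2 = 4 * e + 1} =
    card {(x, y). odd x \<and> 3 dvd x \<and> coprime y 6 \<and> x\<^sup>2 + y\<^sup>2 = 8 * e + 2}"
proof -
  define R where "R = {(u :: int, v :: int). coprime u 6 \<and> coprime v 6 \<and> u\<^sup>2 + 4 * v\<^sup>2 = 4 * int e + 1}"
  define S where "S = {(x :: int, y :: int). odd x \<and> 3 dvd x \<and> coprime y 6 \<and> x\<^sup>2 + y\<^sup>2 = 8 * int e + 2}"
  have finR: "finite R"
    by (rule finite_subset[OF _ finite_weighted_squares[of 1 4 "4 * int e + 1"]]) (auto simp: R_def)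
  have finS: "finite S"
    by (rule finite_subset[OF _ finite_weighted_squares[of 1 1 "8 * int e + 2"]]) (auto simp: S_def)
  \<comment> \<open>Both sets are halves: changing the sign of v destroys 3 | u + 2v, and changing
    the sign of y destroys 4 | x - y because x and y are odd. The image satisfies the latter since
    its coordinates differ by 4v.\<close>
  have "bij_betw (\<lambda>(u, v). (u + 2 * v, u - 2 * v)) {(u, v) \<in> R. 3 dvd u + 2 * v} {(x, y) \<in> S. 4 dvd x - y}"
  proof (rule bij_betwI[where g = "\<lambda>(x, y). ((x + y) div 2, (x - y) div 4)"])
    show "(\<lambda>(u, v). (u + 2 * v, u - 2 * v)) \<in> {(u, v) \<in> R. 3 dvd u + 2 * v} \<rightarrow> {(x, y) \<in> S. 4 dvd x - y}"
    proof clarsimp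
      fix u v assume uv: "(u, v) \<in> R" "3 dvd u + 2 * v"
      have "(u + 2 * v)\<^sup>2 + (u - 2 * v)\<^sup>2 = 2 * (u\<^sup>2 + 4 * v\<^sup>2)"
        by (simp add: power2_eq_square algebra_simps)
      moreover have "odd (u + 2 * v)" "odd (u - 2 * v)" "\<not> 3 dvd u - 2 * v"
        using uv unfolding R_def coprime_6_iff mem_Collect_eq prod.case by presburger+
      ultimately show "(u + 2 * v, u - 2 * v) \<in> S"
        using uv by (simp add: R_def S_def coprime_6_iff)
    qed
    show "(\<lambda>(x, y). ((x + y) div 2, (x - y) div 4)) \<in> {(x, y) \<in> S. 4 dvd x - y} \<rightarrow> {(u, v) \<in> R. 3 dvd u + 2 * v}"
    proof clarsimp
      fix x y assume xy: "(x, y) \<in> S" "4 dvd x - y"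
      then obtain v where "x - y = 4 * v" by (auto elim: dvdE)
      then have x: "x = y + 4 * v" by simp
      have yv: "odd y" "\<not> 3 dvd y" "3 dvd y + 4 * v" "(y + 4 * v)\<^sup>2 + y\<^sup>2 = 8 * int e + 2"
        using xy(1) by (simp_all add: S_def x coprime_6_iff)
      have eq: "(y + 2 * v)\<^sup>2 + 4 * v\<^sup>2 = 4 * int e + 1"
        using yv(4) by (simp add: power2_eq_square algebra_simps)
      have u: "odd (y + 2 * v)" using yv(1) by simp
      \<comment> \<open>Here the oddness of e enters: 4e + 1 is 5 modulo 8, while an even v would
        make it 1.\<close>
      have "odd v"
      proof
        assume "even v"
        then obtain w where "v = 2 * w" ..
        then have "(y + 2 * v)\<^sup>2 + 16 * w\<^sup>2 = 4 * int e + 1" using eq by (simp add: power_mult_distrib)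
        moreover have "odd (int e)" using assms by simp
        ultimately show False using odd_square_mod_8[OF u] by presburger
      qed
      moreover have "\<not> 3 dvd v" "\<not> 3 dvd y + 2 * v" "3 dvd (y + 2 * v) + 2 * v" using yv by presburger+
      ultimately have "(y + 2 * v, v) \<in> R" "3 dvd (y + 2 * v) + 2 * v"
        using u eq by (simp_all add: R_def coprime_6_iff)
      moreover have "(x + y) div 2 = y + 2 * v" "(x - y) div 4 = v" by (simp_all add: x)
      ultimately show "((x + y) div 2, (x - y) div 4) \<in> R \<and> 3 dvd (x + y) div 2 + 2 * ((x - y) div 4)"
        by simp
    qed
  qed (auto elim!: dvdE)
  then have "card {(u, v) \<in> R. 3 dvd u + 2 * v} = card {(x, y) \<in> S. 4 dvd x - y}"
    by (rule bij_betw_same_card)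
  moreover have "card R = 2 * card {(u, v) \<in> R. 3 dvd u + 2 * v}"
  proof (rule card_half[OF finR])
    fix u v assume "(u, v) \<in> R"
    then show "3 dvd u + 2 * - v \<longleftrightarrow> \<not> 3 dvd u + 2 * v"
      unfolding R_def coprime_6_iff mem_Collect_eq prod.case by presburger
  qed (simp add: R_def)
  moreover have "card S = 2 * card {(x, y) \<in> S. 4 dvd x - y}"
  proof (rule card_half[OF finS])
    fix x y assume "(x, y) \<in> S"
    then show "4 dvd x - - y \<longleftrightarrow> \<not> 4 dvd x - y"
      unfolding S_def coprime_6_iff mem_Collect_eq prod.case by presburger
  qed (simp add: S_def)
  moreover have "card R = 4 * card {(u, v) \<in> R. u > 0 \<and> v > 0}"
    by (rule card_quadrants[OF finR]) (auto simp: R_def)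
  moreover have "card S = 4 * card {(x, y) \<in> S. x > 0 \<and> y > 0}"
    by (rule card_quadrants[OF finS]) (auto simp: S_def)
  moreover have "card {(u, v) \<in> R. u > 0 \<and> v > 0} = card {(u, v). coprime u 6 \<and> coprime v 6 \<and> u\<^sup>2 + 4 * v\<^sup>2 = 4 * e + 1}"
  proof (rule card_positive_quadrant)
    fix u v
    have "(int u)\<^sup>2 + 4 * (int v)\<^sup>2 = 4 * int e + 1 \<longleftrightarrow> u\<^sup>2 + 4 * v\<^sup>2 = 4 * e + 1"
      using of_nat_eq_iff[where 'a = int, of "u\<^sup>2 + 4 * v\<^sup>2" "4 * e + 1"]
      by (simp only: of_nat_add of_nat_mult of_nat_power of_nat_numeral of_nat_1)
    then show "0 < u \<and> 0 < v \<and> (int u, int v) \<in> R \<longleftrightarrow> coprime u 6 \<and> coprime v 6 \<and> u\<^sup>2 + 4 * v\<^sup>2 = 4 * e + 1"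
      unfolding R_def mem_Collect_eq prod.case coprime_int_6 using coprime_6_pos[of u] coprime_6_pos[of v] by fast
  qed
  moreover have "card {(x, y) \<in> S. x > 0 \<and> y > 0} = card {(x, y). odd x \<and> 3 dvd x \<and> coprime y 6 \<and> x\<^sup>2 + y\<^sup>2 = 8 * e + 2}"
  proof (rule card_positive_quadrant)
    fix x y
    have "(int x)\<^sup>2 + (int y)\<^sup>2 = 8 * int e + 2 \<longleftrightarrow> x\<^sup>2 + y\<^sup>2 = 8 * e + 2"
      using of_nat_eq_iff[where 'a = int, of "x\<^sup>2 + y\<^sup>2" "8 * e + 2"]
      by (simp only: of_nat_add of_nat_mult of_nat_power of_nat_numeral)
    moreover have "3 dvd int x \<longleftrightarrow> 3 dvd x" using int_dvd_int_iff[of 3 x] by simp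
    moreover have "odd (int x) \<longleftrightarrow> odd x" by simp
    ultimately show "0 < x \<and> 0 < y \<and> (int x, int y) \<in> S \<longleftrightarrow> odd x \<and> 3 dvd x \<and> coprime y 6 \<and> x\<^sup>2 + y\<^sup>2 = 8 * e + 2"
      unfolding S_def mem_Collect_eq prod.case coprime_int_6 using coprime_6_pos[of y] odd_pos[of x] by fast
  qed
  ultimately show ?thesis by simp
qed

section \<open>The 2-dissection\<close>

lemma even_card_swap:
  fixes S :: "('a :: linorder \<times> 'a) set"
  assumes "finite S" "\<And>x y. (x, y) \<in> S \<Longrightarrow> (y, x) \<in> S" "\<And>x. (x, x) \<notin> S"
  shows "even (card S)"
proof -
  let ?A = "{(x, y) \<in> S. x < y}" and ?B = "{(x, y) \<in> S. y < x}"
  have "x < y \<or> y < x" if "(x, y) \<in> S" for x y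
    using assms(3) that by (cases x y rule: linorder_cases) auto
  then have "S = ?A \<union> ?B" by fast
  then have "card S = card (?A \<union> ?B)" by (rule arg_cong)
  also have "\<dots> = card ?A + card ?B"
    by (rule card_Un_disjoint) (auto intro: finite_subset[OF _ assms(1)])
  also have "card ?B = card ?A"
    by (rule bij_betw_same_card[OF bij_betwI[where f = prod.swap and g = prod.swap]]) (use assms(2) in auto)
  finally show ?thesis by simp
qed

lemma of_nat_bit_eq_0_iff: "of_nat n = (0 :: bit) \<longleftrightarrow> even n"
  by (cases "even n") (auto elim!: evenE oddE)

lemma of_int_bit_eq_0_iff: "of_int k = (0 :: bit) \<longleftrightarrow> even k"
  by (cases "even k") (auto elim!: evenE oddE)

lemma finite_pairs_bounded:
  fixes P :: "nat \<Rightarrow> nat \<Rightarrow> bool"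
  assumes "\<And>x y. P x y \<Longrightarrow> x \<le> b \<and> y \<le> b"
  shows "finite {(x, y). P x y}"
  by (rule finite_subset[of _ "{..b} \<times> {..b}"]) (use assms in auto)

text \<open>Frobenius in characteristic 2: squaring replaces q by \<open>q\<^sup>2\<close>, because
  the mixed products of two different exponents in the support cancel in pairs.\<close>

lemma bit_fps_square_nth:
  fixes f :: "bit fps"
  shows "fps_nth (f ^ 2) n = (if even n then fps_nth f (n div 2) else 0)"
proof -
  define S where "S = {i. fps_nth f i = 1}"
  have f: "f = weight_gf S (\<lambda>i. i)"
  proof (rule fps_ext)
    fix n
    have "{i \<in> S. i = n} = (if fps_nth f n = 1 then {n} else {})" by (auto simp: S_def)
    then show "fps_nth f n = fps_nth (weight_gf S (\<lambda>i. i)) n" by simp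
  qed
  define T where "T = {(i, j). i \<in> S \<and> j \<in> S \<and> i + j = n}"
  have finT: "finite T" unfolding T_def by (rule finite_pairs_bounded[of _ n]) auto
  have "f * f = weight_gf (S \<times> S) (\<lambda>(i, j). i + j)"
    unfolding f by (rule weight_gf_mult) (auto intro: finite_subset[of _ "{n}" for n])
  moreover have "{z \<in> S \<times> S. (case z of (i, j) \<Rightarrow> i + j) = n} = T" by (auto simp: T_def)
  ultimately have nth: "fps_nth (f ^ 2) n = of_nat (card T)"
    by (simp add: power2_eq_square)
  let ?D = "{z \<in> T. fst z = snd z}" and ?O = "{z \<in> T. fst z \<noteq> snd z}"
  have "card (?D \<union> ?O) = card ?D + card ?O"
    by (rule card_Un_disjoint) (auto intro: finite_subset[OF _ finT])
  moreover have "?D \<union> ?O = T" by auto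
  moreover have "even (card ?O)"
    by (rule even_card_swap) (use finT in \<open>auto simp: T_def add.commute\<close>)
  moreover have "?D = (if even n \<and> n div 2 \<in> S then {(n div 2, n div 2)} else {})"
    by (auto simp: T_def)
  ultimately have "even (card T) \<longleftrightarrow> \<not> (even n \<and> n div 2 \<in> S)" by auto
  then show ?thesis
    using of_nat_bit_eq_0_iff[of "card T"] unfolding nth by (auto simp: S_def)
qed

lemma square_of_even_part:
  fixes f :: "bit fps"
  assumes "\<And>n. odd n \<Longrightarrow> fps_nth f n = 0"
  obtains g where "f = g ^ 2"
proof
  show "f = Abs_fps (\<lambda>n. fps_nth f (2 * n)) ^ 2"
    by (rule fps_ext) (use assms in \<open>simp add: bit_fps_square_nth\<close>)
qed

lemma coprime_6_square:
  fixes x :: nat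
  assumes "coprime x 6"
  shows "x\<^sup>2 = 24 * ((x\<^sup>2 - 1) div 24) + 1"
proof -
  have "x mod 24 = 1 \<or> x mod 24 = 5 \<or> x mod 24 = 7 \<or> x mod 24 = 11 \<or>
      x mod 24 = 13 \<or> x mod 24 = 17 \<or> x mod 24 = 19 \<or> x mod 24 = 23"
    using assms unfolding coprime_6_iff_nat by presburger
  then have "(x mod 24)\<^sup>2 mod 24 = 1" by (elim disjE) simp_all
  then have "x\<^sup>2 mod 24 = 1" by (simp add: power_mod)
  then have "x\<^sup>2 = 24 * (x\<^sup>2 div 24) + 1"
    using mult_div_mod_eq[of 24 "x\<^sup>2"] by simp
  then obtain q where "x\<^sup>2 = 24 * q + 1" ..
  then show ?thesis by simp
qed

lemma finite_pentagonal_fibre: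
  assumes "i > 0"
  shows "finite {x \<in> {x :: nat. coprime x 6}. i * ((x\<^sup>2 - 1) div 24) = n}"
proof (rule finite_subset)
  show "{x \<in> {x :: nat. coprime x 6}. i * ((x\<^sup>2 - 1) div 24) = n} \<subseteq> {..24 * n + 1}"
  proof (intro subsetI, clarsimp)
    fix x :: nat assume "coprime x 6"
    have "x \<le> x\<^sup>2" by (simp add: power2_eq_square)
    also have "x\<^sup>2 = 24 * ((x\<^sup>2 - 1) div 24) + 1" by (rule coprime_6_square) fact
    also have "\<dots> \<le> 24 * (i * ((x\<^sup>2 - 1) div 24)) + 1" using assms by simp
    finally show "x \<le> Suc (24 * (i * ((x\<^sup>2 - Suc 0) div 24)))" by simp
  qed
qed simp

lemma euler2_mult_nth:
  assumes "i > 0" "j > 0"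
  shows "fps_nth (euler2 i * euler2 j) n =
    of_nat (card {(x, y). coprime x 6 \<and> coprime y 6 \<and> i * x\<^sup>2 + j * y\<^sup>2 = 24 * n + i + j})"
proof -
  have "euler2 i * euler2 j = weight_gf ({x. coprime x 6} \<times> {x. coprime x 6})
      (\<lambda>(x, y). i * ((x\<^sup>2 - 1) div 24) + j * ((y\<^sup>2 - 1) div 24))"
    unfolding euler2_pentagonal[OF assms(1)] euler2_pentagonal[OF assms(2)]
    by (rule weight_gf_mult) (rule finite_pentagonal_fibre, fact)+
  moreover have iff: "i * ((x\<^sup>2 - 1) div 24) + j * ((y\<^sup>2 - 1) div 24) = n \<longleftrightarrow> i * x\<^sup>2 + j * y\<^sup>2 = 24 * n + i + j"
    if "coprime x 6" "coprime y 6" for x y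
  proof -
    define s t where "s = (x\<^sup>2 - 1) div 24" and "t = (y\<^sup>2 - 1) div 24"
    have x: "x\<^sup>2 = 24 * s + 1" and y: "y\<^sup>2 = 24 * t + 1"
      unfolding s_def t_def using that by (simp_all only: coprime_6_square[symmetric])
    define a where "a = i * s + j * t"
    have "i * x\<^sup>2 + j * y\<^sup>2 = 24 * a + i + j" unfolding x y a_def by (simp add: algebra_simps)
    then show ?thesis unfolding s_def[symmetric] t_def[symmetric] a_def[symmetric] by simp
  qed
  then have "{z \<in> {x. coprime x 6} \<times> {x. coprime x 6}. (case z of (x, y) \<Rightarrow> i * ((x\<^sup>2 - 1) div 24) + j * ((y\<^sup>2 - 1) div 24)) = n} =
      {(x, y). coprime x 6 \<and> coprime y 6 \<and> i * x\<^sup>2 + j * y\<^sup>2 = 24 * n + i + j}"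
  proof (intro Collect_cong)
    fix z :: "nat \<times> nat"
    show "(z \<in> {x. coprime x 6} \<times> {x. coprime x 6} \<and>
        (case z of (x, y) \<Rightarrow> i * ((x\<^sup>2 - 1) div 24) + j * ((y\<^sup>2 - 1) div 24)) = n) =
        (case z of (x, y) \<Rightarrow> coprime x 6 \<and> coprime y 6 \<and> i * x\<^sup>2 + j * y\<^sup>2 = 24 * n + i + j)"
      using iff[of "fst z" "snd z"]
      by (cases z) (simp only: mem_Sigma_iff mem_Collect_eq prod.case fst_conv snd_conv, argo)
  qed
  ultimately show ?thesis by simp
qed

text \<open>Multiplying exponents by 8 completes both squares: the triangular numbers become
  \<open>(2 * k + 1)\<^sup>2 - 1\<close>, and the exponents of f_3 become
  \<open>y\<^sup>2 - 1\<close>.\<close>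

lemma euler2_cube_mult_nth:
  "fps_nth (euler2 1 ^ 3 * euler2 3) e = of_nat (card {(x, y). odd x \<and> coprime y 6 \<and> x\<^sup>2 + y\<^sup>2 = 8 * e + 2})"
proof -
  have fin: "finite {k \<in> UNIV. k * (k + 1) div 2 = n}" for n :: nat
  proof (rule finite_subset)
    show "{k \<in> UNIV. k * (k + 1) div 2 = n} \<subseteq> {..2 * n + 1}"
    proof
      fix k assume "k \<in> {k \<in> UNIV. k * (k + 1) div 2 = n}"
      then have "k * (k + 1) \<le> 2 * n + 1" by auto
      moreover have "k \<le> k * (k + 1)" by simp
      ultimately show "k \<in> {..2 * n + 1}" by simp
    qed
  qed simp
  have "euler2 1 ^ 3 * euler2 3 = weight_gf (UNIV \<times> {x. coprime x 6})
      (\<lambda>(k, y). k * (k + 1) div 2 + 3 * ((y\<^sup>2 - 1) div 24))"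
    unfolding euler2_cube euler2_pentagonal[OF zero_less_numeral, of "num.Bit1 num.One"]
    by (rule weight_gf_mult[OF fin]) (rule finite_pentagonal_fibre, simp)
  moreover have "card {z \<in> UNIV \<times> {x. coprime x 6}. (case z of (k, y) \<Rightarrow> k * (k + 1) div 2 + 3 * ((y\<^sup>2 - 1) div 24)) = e} =
      card {(x, y). odd x \<and> coprime y 6 \<and> x\<^sup>2 + y\<^sup>2 = 8 * e + 2}"
  proof (rule bij_betw_same_card[OF bij_betwI[where f = "\<lambda>(k, y). (2 * k + 1, y)" and g = "\<lambda>(x, y). (x div 2, y)"]])
    have iff: "k * (k + 1) div 2 + 3 * ((y\<^sup>2 - 1) div 24) = e \<longleftrightarrow> (2 * k + 1)\<^sup>2 + y\<^sup>2 = 8 * e + 2"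
      if "coprime y 6" for k y
    proof -
      define t where "t = (y\<^sup>2 - 1) div 24"
      have y: "y\<^sup>2 = 24 * t + 1" unfolding t_def using that by (rule coprime_6_square)
      have "even (k * (k + 1))" by simp
      then obtain m where m: "k * (k + 1) = 2 * m" ..
      have "(2 * k + 1)\<^sup>2 = 4 * (k * (k + 1)) + 1" by (simp add: power2_eq_square algebra_simps)
      then have k: "(2 * k + 1)\<^sup>2 = 8 * m + 1" unfolding m by simp
      show ?thesis unfolding k y m t_def[symmetric] by auto
    qed
    show "(\<lambda>(k, y). (2 * k + 1, y)) \<in> {z \<in> UNIV \<times> {x. coprime x 6}. (case z of (k, y) \<Rightarrow> k * (k + 1) div 2 + 3 * ((y\<^sup>2 - 1) div 24)) = e} \<rightarrow>
        {(x, y). odd x \<and> coprime y 6 \<and> x\<^sup>2 + y\<^sup>2 = 8 * e + 2}"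
    proof (rule Pi_I)
      fix z assume z: "z \<in> {z \<in> UNIV \<times> {x. coprime x 6}. (case z of (k, y) \<Rightarrow> k * (k + 1) div 2 + 3 * ((y\<^sup>2 - 1) div 24)) = e}"
      obtain k y where ky: "z = (k, y)" by (cases z)
      have "coprime y 6" "(2 * k + 1)\<^sup>2 + y\<^sup>2 = 8 * e + 2"
        using z iff[of y k] unfolding ky mem_Collect_eq prod.case mem_Sigma_iff by blast+
      then show "(case z of (k, y) \<Rightarrow> (2 * k + 1, y)) \<in> {(x, y). odd x \<and> coprime y 6 \<and> x\<^sup>2 + y\<^sup>2 = 8 * e + 2}"
        unfolding ky mem_Collect_eq prod.case by simp
    qed
    show "(\<lambda>(x, y). (x div 2, y)) \<in> {(x, y). odd x \<and> coprime y 6 \<and> x\<^sup>2 + y\<^sup>2 = 8 * e + 2} \<rightarrow>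
        {z \<in> UNIV \<times> {x. coprime x 6}. (case z of (k, y) \<Rightarrow> k * (k + 1) div 2 + 3 * ((y\<^sup>2 - 1) div 24)) = e}"
    proof (rule Pi_I)
      fix z assume z: "z \<in> {(x, y). odd x \<and> coprime y 6 \<and> x\<^sup>2 + y\<^sup>2 = 8 * e + 2}"
      then obtain k y where ky: "z = (2 * k + 1, y)" by (auto elim!: oddE)
      have "coprime y 6" "k * (k + 1) div 2 + 3 * ((y\<^sup>2 - 1) div 24) = e"
        using z iff[of y k] unfolding ky mem_Collect_eq prod.case by blast+
      moreover have "(2 * k + 1) div 2 = k" by simp
      ultimately show "(case z of (x, y) \<Rightarrow> (x div 2, y)) \<in> {z \<in> UNIV \<times> {x. coprime x 6}. (case z of (k, y) \<Rightarrow> k * (k + 1) div 2 + 3 * ((y\<^sup>2 - 1) div 24)) = e}"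
        unfolding ky mem_Collect_eq prod.case mem_Sigma_iff by simp
    qed
  qed (auto elim!: oddE)
  ultimately show ?thesis by simp
qed

text \<open>Solutions of \<open>x\<^sup>2 + y\<^sup>2 = 8 e + 2\<close> with both entries prime to 3 cancel in pairs under swapping.\<close>

lemma odd_part_cube_mult:
  assumes "odd e"
  shows "fps_nth (euler2 1 ^ 3 * euler2 3) e = fps_nth (euler2 6 * euler2 24) (e - 1)"
proof -
  let ?S = "{(x, y). odd x \<and> coprime y 6 \<and> x\<^sup>2 + y\<^sup>2 = 8 * e + 2}"
  let ?S3 = "{(x, y). odd x \<and> 3 dvd x \<and> coprime y 6 \<and> x\<^sup>2 + y\<^sup>2 = 8 * e + 2}"
  let ?S' = "{(x, y). coprime x 6 \<and> coprime y 6 \<and> x\<^sup>2 + y\<^sup>2 = 8 * e + 2}"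
  have bound: "x \<le> 8 * e + 2 \<and> y \<le> 8 * e + 2" if "x\<^sup>2 + y\<^sup>2 = 8 * e + 2" for x y :: nat
  proof -
    have "x \<le> x\<^sup>2" "y \<le> y\<^sup>2" by (simp_all add: power2_eq_square)
    then show ?thesis using that by linarith
  qed
  have fin: "finite ?S3" "finite ?S'"
    by (rule finite_pairs_bounded[of _ "8 * e + 2"]; use bound in blast)+
  have "?S = ?S3 \<union> ?S'" by (auto simp: coprime_6_iff_nat)
  moreover have "?S3 \<inter> ?S' = {}" by (auto simp: coprime_6_iff_nat)
  ultimately have "card ?S = card ?S3 + card ?S'" using fin by (simp only: card_Un_disjoint)
  moreover have "even (card ?S')"
  proof (rule even_card_swap[OF fin(2)])
    \<comment> \<open>A fixed point of the swap would give e = 6q, contrary to e being odd.\<close>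
    fix x
    have "x\<^sup>2 + x\<^sup>2 \<noteq> 8 * e + 2" if cop: "coprime x 6"
    proof
      assume "x\<^sup>2 + x\<^sup>2 = 8 * e + 2"
      moreover obtain q where "x\<^sup>2 = 24 * q + 1" using coprime_6_square[OF cop] by blast
      ultimately have "e = 6 * q" by simp
      then show False using assms by simp
    qed
    then show "(x, x) \<notin> ?S'" by auto
  qed (auto simp: add.commute)
  then obtain k where "card ?S' = 2 * k" ..
  ultimately have "card ?S = card ?S3 + 2 * k" by (simp only:)
  then have "(of_nat (card ?S) :: bit) = of_nat (card ?S3) + of_nat (2 * k)" by (simp only: of_nat_add)
  also have "(of_nat (2 * k) :: bit) = 0" by (simp only: of_nat_bit_eq_0_iff dvd_triv_left)
  finally have "(of_nat (card ?S) :: bit) = of_nat (card ?S3)" by (simp only: add_0_right)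
  also have "\<dots> = of_nat (card {(u, v). coprime u 6 \<and> coprime v 6 \<and> u\<^sup>2 + 4 * v\<^sup>2 = 4 * e + 1})"
    by (simp only: card_rotated_forms[OF assms])
  also have "{(u, v). coprime u 6 \<and> coprime v 6 \<and> u\<^sup>2 + 4 * v\<^sup>2 = 4 * e + 1} =
      {(u, v). coprime u 6 \<and> coprime v 6 \<and> 6 * u\<^sup>2 + 24 * v\<^sup>2 = 24 * (e - 1) + 6 + 24}"
  proof -
    have "e \<ge> 1" using assms by (cases e) auto
    then have "u\<^sup>2 + 4 * v\<^sup>2 = 4 * e + 1 \<longleftrightarrow> 6 * u\<^sup>2 + 24 * v\<^sup>2 = 24 * (e - 1) + 6 + 24" for u v :: nat
      by linarith
    then show ?thesis by simp
  qed
  finally show ?thesis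
    by (simp only: euler2_cube_mult_nth euler2_mult_nth zero_less_numeral)
qed

text \<open>With H = f_1^3 f_3 one has G f_24 = H f_4 modulo 2. By \<open>odd_part_cube_mult\<close>
  the odd part of H is q f_6 f_24, and f_4 and f_24 are even series, so the odd part of G is q f_4
  f_6. Halving the exponents of f_4 f_6 yields f_2 f_3.\<close>

lemma b_reg_mod_2:
  "of_nat (b_reg 3 8 (2 * n + 1)) = fps_nth (euler2 2 * euler2 3) n"
proof -
  define G :: "bit fps" where "G = Abs_fps (\<lambda>n. of_nat (b_reg 3 8 n))"
  define H where "H = euler2 1 ^ 3 * euler2 3"
  have E: "euler2 2 = euler2 1 ^ 2" "euler2 4 = euler2 2 ^ 2" "euler2 8 = euler2 4 ^ 2"
    "euler2 24 = euler2 12 ^ 2" "euler2 6 = euler2 3 ^ 2"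
    using euler2_square[of 1] euler2_square[of 2] euler2_square[of 4] euler2_square[of 12] euler2_square[of 3]
    by simp_all
  have c: "coprime 3 (8 :: nat)" by (simp add: coprime_iff_gcd_eq_1 gcd_non_0_nat)
  have "G * (euler2 1 * euler2 24) = euler2 3 * euler2 8"
    using b_reg_gf[OF c] by (simp add: G_def)
  then have "euler2 1 * (G * euler2 24) = euler2 1 * (H * euler2 4)"
    unfolding H_def E(1-3) by (simp add: algebra_simps power2_eq_square power3_eq_cube)
  then have GH: "G * euler2 24 = H * euler2 4" using euler2_nonzero[of 1] by simp
  have "fps_nth (H - fps_X * (euler2 6 * euler2 24)) e = 0" if "odd e" for e
    using that odd_part_cube_mult[OF that] odd_pos[OF that] by (simp add: H_def)
  then obtain s where s: "H - fps_X * (euler2 6 * euler2 24) = s ^ 2" by (rule square_of_even_part)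
  define w where "w = inverse (euler2 12)"
  have w: "euler2 12 * w = 1"
    unfolding w_def using euler2_nth_0[of 12] by (simp add: inverse_mult_eq_1')
  \<comment> \<open>G minus its expected odd part. Exhibiting D as a square shows that its odd
    coefficients vanish; f_24 is divided away as the square of f_12.\<close>
  define D where "D = G - fps_X * (euler2 4 * euler2 6)"
  have "D * euler2 24 = (H - fps_X * (euler2 6 * euler2 24)) * euler2 4"
    unfolding D_def left_diff_distrib GH by (simp only: ac_simps)
  also have "\<dots> = (s * euler2 2) ^ 2" unfolding s E(2) by (simp only: power_mult_distrib)
  finally have "D * (euler2 12 * w) ^ 2 = (s * euler2 2 * w) ^ 2"
    unfolding E(4) power_mult_distrib by (simp only: mult.assoc[symmetric])
  then have "D = (s * euler2 2 * w) ^ 2" by (simp add: w)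
  then have "fps_nth D (2 * n + 1) = 0" by (simp only: bit_fps_square_nth) simp
  then have "fps_nth G (2 * n + 1) = fps_nth (fps_X * (euler2 4 * euler2 6)) (2 * n + 1)"
    unfolding D_def fps_sub_nth by (rule eq_iff_diff_eq_0[THEN iffD2])
  also have "\<dots> = fps_nth (euler2 4 * euler2 6) (2 * n)" by simp
  also have "euler2 4 * euler2 6 = (euler2 2 * euler2 3) ^ 2"
    unfolding E(2,5) by (simp only: power_mult_distrib)
  also have "fps_nth \<dots> (2 * n) = fps_nth (euler2 2 * euler2 3) n" by (simp add: bit_fps_square_nth)
  finally show ?thesis by (simp add: G_def)
qed

lemma euler2_2_3_nth: "fps_nth (euler2 2 * euler2 3) n = of_nat (rep_count (24 * n + 5))"
proof -
  have "fps_nth (euler2 2 * euler2 3) n =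
      of_nat (card {(x, y). coprime x 6 \<and> coprime y 6 \<and> 2 * x\<^sup>2 + 3 * y\<^sup>2 = 24 * n + 2 + 3})"
    by (rule euler2_mult_nth) simp_all
  also have "24 * n + 2 + 3 = 24 * n + (5 :: nat)" by simp
  finally show ?thesis unfolding rep_count_def .
qed

lemma even_b_reg_iff: "even (b_reg 3 8 (2 * n + 1)) \<longleftrightarrow> even (rep_count (24 * n + 5))"
  using b_reg_mod_2[of n] unfolding euler2_2_3_nth by (metis of_nat_bit_eq_0_iff)

lemma even_b_seq_iff: "even (b_seq n) \<longleftrightarrow> even (rep_count (24 * n + 5))"
proof -
  have "of_int (b_seq n) = fps_nth (fps_mod2 (euler_f 1 ^ 2 * euler_f 3)) n"
    by (simp add: b_seq_def)
  also have "\<dots> = fps_nth (euler2 2 * euler2 3) n"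
    using euler2_square[of 1] by (simp add: fps_mod2_mult fps_mod2_power euler2_def)
  finally show ?thesis unfolding euler2_2_3_nth by (metis of_nat_bit_eq_0_iff of_int_bit_eq_0_iff)
qed

section \<open>Parity along the progressions\<close>

text \<open>The fractions 5/12 and 7/12 of the theorem are exactly those for which the index 2m + 1
  satisfies 24m + 5 = \<open>24 * p ^ a * n + 5 * p ^ (2 * k)\<close>.\<close>

lemma even_b_reg_progression:
  fixes p :: nat
  assumes "prime p" "p \<ge> 5"
  shows "even (b_reg 3 8 (2 * p ^ a * n + (5 * p ^ (2 * k) + 7) div 12)) \<longleftrightarrow>
    even (rep_count (24 * p ^ a * n + 5 * p ^ (2 * k)))"
proof -
  have "p ^ (2 * k) mod 24 = (p\<^sup>2 mod 24) ^ k mod 24" by (simp add: power_mult power_mod)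
  then have "p ^ (2 * k) mod 24 = 1" by (simp add: prime_square_mod_24[OF assms])
  then have "p ^ (2 * k) = 24 * (p ^ (2 * k) div 24) + 1"
    using mult_div_mod_eq[of 24 "p ^ (2 * k)"] by simp
  then obtain r where r: "p ^ (2 * k) = 24 * r + 1" ..
  have "(5 * p ^ (2 * k) + 7) div 12 = 10 * r + 1" unfolding r by simp
  then have 1: "2 * p ^ a * n + (5 * p ^ (2 * k) + 7) div 12 = 2 * (p ^ a * n + 5 * r) + 1" by simp
  have 2: "24 * p ^ a * n + 5 * p ^ (2 * k) = 24 * (p ^ a * n + 5 * r) + 5" unfolding r by simp
  show ?thesis unfolding 1 2 by (rule even_b_reg_iff)
qed

lemma rep_count_5: "rep_count 5 = 1"
proof -
  have "x = 1 \<and> y = 1" if "coprime x 6" "coprime y 6" "2 * x\<^sup>2 + 3 * y\<^sup>2 = 5" for x y :: nat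
  proof -
    have "x > 0" "y > 0" using that coprime_6_pos by blast+
    then have "x\<^sup>2 \<ge> 1" "y\<^sup>2 \<ge> 1" by simp_all
    then have "x\<^sup>2 = 1" "y\<^sup>2 = 1" using that(3) by linarith+
    then show ?thesis by simp
  qed
  then have "{(x :: nat, y :: nat). coprime x 6 \<and> coprime y 6 \<and> 2 * x\<^sup>2 + 3 * y\<^sup>2 = 5} = {(1, 1)}" by auto
  then show ?thesis by (simp add: rep_count_def)
qed

lemma even_Legendre_iff: "even (Legendre a p) \<longleftrightarrow> p dvd a"
  by (auto simp: Legendre_def cong_0_iff)

text \<open>At N = 5 one has A(5) = 1, so c has the parity of A(\<open>5 * p\<^sup>2\<close>) plus
  1, or without the 1 if p = 5. The Legendre product in \<open>omega\<close> supplies this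
  correction: modulo 2 it only records whether p divides 5.\<close>

lemma even_omega_iff:
  fixes p :: nat
  assumes p: "prime p" "p \<ge> 5"
    and hecke: "\<And>N. N mod 24 = 5 \<Longrightarrow>
      even (rep_count (p\<^sup>2 * N) + (if p dvd N then 0 else rep_count N) +
        (if p\<^sup>2 dvd N then rep_count (N div p\<^sup>2) else 0) + c * rep_count N)"
  shows "even (omega p) \<longleftrightarrow> even c"
proof -
  have P: "prime (int p)" using p by simp
  have "24 * (5 * (p\<^sup>2 - 1) div 24) = 5 * (p\<^sup>2 - 1)" using dvd_24_omega_argument(1)[OF p] by simp
  moreover have "p\<^sup>2 \<ge> 1" using p by simp
  ultimately have arg: "24 * (5 * (p\<^sup>2 - 1) div 24) + 5 = p\<^sup>2 * 5" by simp
  have five: "p dvd 5 \<longleftrightarrow> p = 5" using primes_dvd_imp_eq[of p 5] p(1) by auto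
  have "even (Legendre (- 6) (int p) * Legendre (- (5 * ((int p)\<^sup>2 - 1) div 24)) (int p)) \<longleftrightarrow> p = 5"
  proof -
    define m where "m = 5 * ((int p)\<^sup>2 - 1) div 24"
    have m: "24 * m = 5 * (int p)\<^sup>2 - 5" using dvd_24_omega_argument(2)[OF p] by (simp add: m_def)
    have "\<not> int p dvd 2" "\<not> int p dvd 3" using p(2) zdvd_not_zless[of 2 "int p"] zdvd_not_zless[of 3 "int p"] by auto
    then have n: "\<not> int p dvd 2 * 3" "\<not> int p dvd 2 * 2 * 2 * 3"
      using P by (simp_all only: prime_dvd_mult_iff simp_thms)
    have "int p dvd m \<longleftrightarrow> int p dvd 24 * m" using n(2) P by (simp add: prime_dvd_mult_iff)
    also have "\<dots> \<longleftrightarrow> int p dvd 5"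
      unfolding m by (rule dvd_diff_right_iff) (simp add: power2_eq_square)
    also have "\<dots> \<longleftrightarrow> p = 5" using five int_dvd_int_iff[of p 5] by simp
    finally show ?thesis using n(1) unfolding m_def[symmetric] by (simp add: even_Legendre_iff)
  qed
  moreover have "even (b_seq (5 * (p\<^sup>2 - 1) div 24)) \<longleftrightarrow> even (rep_count (p\<^sup>2 * 5))"
    unfolding even_b_seq_iff arg ..
  moreover have "\<not> p\<^sup>2 dvd 5"
  proof
    assume "p\<^sup>2 dvd 5"
    then have "p\<^sup>2 \<le> 5" by (rule dvd_imp_le) simp
    moreover have "5 * 5 \<le> p\<^sup>2" unfolding power2_eq_square using p(2) by (intro mult_mono) auto
    ultimately show False by simp
  qed
  ultimately show ?thesis
    using hecke[of 5] by (auto simp: omega_def rep_count_5 five)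
qed

lemma even_recurrence_period_2:
  fixes h :: "nat \<Rightarrow> nat"
  assumes "\<And>i. even (h (Suc (Suc i)) + h i + c * h (Suc i))" "even c" "even (h k)"
  shows "even (h (2 * j + k))"
proof (induction j)
  case (Suc j)
  have "2 * Suc j + k = Suc (Suc (2 * j + k))" by simp
  then show ?case using Suc.IH assms(1)[of "2 * j + k"] assms(2) by simp
qed (use assms(3) in simp)

text \<open>For odd c this is the Fibonacci recurrence modulo 2, which has period 3; for even c
  above, terms two apart have equal parity. A step in i multiplies by \<open>p\<^sup>2\<close>,
  whence the steps 6j and 4j in the exponents.\<close>

lemma even_recurrence_period_3:
  fixes h :: "nat \<Rightarrow> nat"
  assumes "\<And>i. even (h (Suc (Suc i)) + h i + c * h (Suc i))" "odd c" "even (h k)"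
  shows "even (h (3 * j + k))"
proof (induction j)
  case (Suc j)
  have eq: "3 * Suc j + k = Suc (Suc (Suc (3 * j + k)))" by simp
  show ?case
    unfolding eq using Suc.IH assms(1)[of "3 * j + k"] assms(1)[of "Suc (3 * j + k)"] assms(2) by auto
qed (use assms(3) in simp)

theorem theorem1p1:
  fixes p :: nat
  assumes "prime p" and "p \<ge> 5"
  shows
    "([omega p = 0] (mod 2) \<longrightarrow>
       (\<forall>n j. \<not> p dvd n \<longrightarrow>
         [b_reg 3 8 (2 * p ^ (4 * j + 3) * n + (5 * p ^ (4 * j + 4) + 7) div 12) = 0] (mod 2))) \<and>
     (\<not> [omega p = 0] (mod 2) \<longrightarrow>
       (\<forall>n j. \<not> p dvd 24 * n + 5 \<longrightarrow>
         [b_reg 3 8 (2 * p ^ (6 * j + 2) * n + (5 * p ^ (6 * j + 2) + 7) div 12) = 0] (mod 2)) \<and>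
       (\<forall>n j. \<not> p dvd n \<longrightarrow>
         [b_reg 3 8 (2 * p ^ (6 * j + 5) * n + (5 * p ^ (6 * j + 6) + 7) div 12) = 0] (mod 2)))"
proof -
  obtain c :: nat where hecke: "\<And>N. N mod 24 = 5 \<Longrightarrow>
      even (rep_count (p\<^sup>2 * N) + (if p dvd N then 0 else rep_count N) +
        (if p\<^sup>2 dvd N then rep_count (N div p\<^sup>2) else 0) + c * rep_count N)"
    using rep_count_hecke[OF assms] by blast
  have omega: "even (omega p) \<longleftrightarrow> even c"
    by (rule even_omega_iff[OF assms hecke])
  have pos: "p > 0" using assms by simp
  define g where "g M i = rep_count (p ^ (2 * i) * M)" for M i
  have mod: "p ^ (2 * i) * M mod 24 = 5" if "M mod 24 = 5" for M i
  proof (induction i)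
    case (Suc i)
    then show ?case
      using square_mult_mod_24[OF assms, of "p ^ (2 * i) * M"] by (simp add: power_add power2_eq_square mult.assoc)
  qed (use that in simp)
  \<comment> \<open>Start of the recurrence: if \<open>p\<^sup>2\<close> does not divide M there is
    no predecessor term, and the outcome depends on whether p divides M.\<close>
  have g_0: "even (g M 1 + (if p dvd M then 0 else g M 0) + c * g M 0)"
    if "M mod 24 = 5" "\<not> p\<^sup>2 dvd M" for M
    using hecke[OF that(1)] that(2) by (simp add: g_def split: if_splits)
  have g_step: "even (g M (Suc (Suc i)) + g M i + c * g M (Suc i))" if "M mod 24 = 5" for M i
  proof -
    define N where "N = p ^ (2 * i) * M"
    have "p ^ (2 * Suc i) * M = p\<^sup>2 * N" "p ^ (2 * Suc (Suc i)) * M = p\<^sup>2 * (p\<^sup>2 * N)"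
      by (simp_all add: N_def power_add power2_eq_square mult.assoc)
    moreover have "p\<^sup>2 * N mod 24 = 5" using mod[OF that, of i] square_mult_mod_24[OF assms] by (simp add: N_def)
    moreover have "p dvd p\<^sup>2 * N" "p\<^sup>2 * N div p\<^sup>2 = N" using pos by (simp_all add: power2_eq_square)
    ultimately show ?thesis
      using hecke[of "p\<^sup>2 * N"] by (simp add: g_def N_def[symmetric])
  qed
  \<comment> \<open>The progressions with p not dividing n correspond to M divisible by p exactly
    once: \<open>p ^ (2 * i) * M\<close> with i = 2j + 1 or 3j + 2 is then the required argument of
    \<open>rep_count\<close>.\<close>
  have ramified: "p * (24 * n + 5 * p) mod 24 = 5" "p dvd p * (24 * n + 5 * p)" "\<not> p\<^sup>2 dvd p * (24 * n + 5 * p)"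
    if "\<not> p dvd n" for n
  proof -
    have "p * (24 * n + 5 * p) = 24 * (p * n) + p\<^sup>2 * 5" by (simp add: power2_eq_square algebra_simps)
    then have "p * (24 * n + 5 * p) mod 24 = p\<^sup>2 * 5 mod 24" by simp
    then show "p * (24 * n + 5 * p) mod 24 = 5" using square_mult_mod_24[OF assms, of 5] by simp
    have "\<not> p dvd 2" "\<not> p dvd 3" using assms(2) nat_dvd_not_less[of 2 p] nat_dvd_not_less[of 3 p] by auto
    then have "\<not> p dvd 2 * 2 * 2 * 3 * n" using that assms(1) by (simp only: prime_dvd_mult_iff simp_thms)
    then have "\<not> p dvd 24 * n + 5 * p" by simp
    then show "\<not> p\<^sup>2 dvd p * (24 * n + 5 * p)" using pos by (simp add: power2_eq_square)
  qed simp
  have first: "even (b_reg 3 8 (2 * p ^ (4 * j + 3) * n + (5 * p ^ (4 * j + 4) + 7) div 12))"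
    if "even c" "\<not> p dvd n" for n j
  proof -
    define M where "M = p * (24 * n + 5 * p)"
    note M = ramified[OF that(2), folded M_def]
    have "even (g M 1)" using g_0[OF M(1,3)] M(2) that(1) by simp
    then have "even (g M (2 * j + 1))"
      by (rule even_recurrence_period_2[where h = "g M" and c = c, OF g_step[OF M(1)] that(1)])
    also have "g M (2 * j + 1) = rep_count (24 * p ^ (4 * j + 3) * n + 5 * p ^ (2 * (2 * j + 2)))"
      unfolding g_def M_def by (rule arg_cong[of _ _ rep_count]) (simp add: power_add algebra_simps eval_nat_numeral)
    finally have "even (b_reg 3 8 (2 * p ^ (4 * j + 3) * n + (5 * p ^ (2 * (2 * j + 2)) + 7) div 12))"
      unfolding even_b_reg_progression[OF assms] .
    moreover have "2 * (2 * j + 2) = 4 * j + 4" by simp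
    ultimately show ?thesis by (simp only:)
  qed
  have second: "even (b_reg 3 8 (2 * p ^ (6 * j + 2) * n + (5 * p ^ (6 * j + 2) + 7) div 12))"
    if "odd c" "\<not> p dvd 24 * n + 5" for n j
  proof -
    define M where "M = 24 * n + 5"
    have M: "M mod 24 = 5" "\<not> p dvd M" "\<not> p\<^sup>2 dvd M"
      using that(2) by (auto simp: M_def power2_eq_square dest: dvd_mult_left)
    \<comment> \<open>As p does not divide M, \<open>g M 1\<close> has the parity of (1 + c)
      \<open>g M 0\<close>, and c is odd.\<close>
    have "even (g M 1)" using g_0[OF M(1,3)] M(2) that(1) by auto
    then have "even (g M (3 * j + 1))"
      by (rule even_recurrence_period_3[where h = "g M" and c = c, OF g_step[OF M(1)] that(1)])
    also have "g M (3 * j + 1) = rep_count (24 * p ^ (6 * j + 2) * n + 5 * p ^ (2 * (3 * j + 1)))"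
      unfolding g_def M_def by (rule arg_cong[of _ _ rep_count]) (simp add: power_add algebra_simps)
    finally have "even (b_reg 3 8 (2 * p ^ (6 * j + 2) * n + (5 * p ^ (2 * (3 * j + 1)) + 7) div 12))"
      unfolding even_b_reg_progression[OF assms] .
    moreover have "2 * (3 * j + 1) = 6 * j + 2" by simp
    ultimately show ?thesis by (simp only:)
  qed
  have third: "even (b_reg 3 8 (2 * p ^ (6 * j + 5) * n + (5 * p ^ (6 * j + 6) + 7) div 12))"
    if "odd c" "\<not> p dvd n" for n j
  proof -
    define M where "M = p * (24 * n + 5 * p)"
    note M = ramified[OF that(2), folded M_def]
    \<comment> \<open>Now \<open>g M 1\<close> and \<open>g M 0\<close> have equal parity, so for
      odd c the next term is even; hence the offset 2.\<close>
    have "even (g M (Suc (Suc 0)))"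
      using g_0[OF M(1,3)] M(2) g_step[OF M(1), of 0] that(1) by auto
    then have "even (g M 2)" by (simp only: numeral_2_eq_2)
    then have "even (g M (3 * j + 2))"
      by (rule even_recurrence_period_3[where h = "g M" and c = c, OF g_step[OF M(1)] that(1)])
    also have "g M (3 * j + 2) = rep_count (24 * p ^ (6 * j + 5) * n + 5 * p ^ (2 * (3 * j + 3)))"
      unfolding g_def M_def by (rule arg_cong[of _ _ rep_count]) (simp add: power_add algebra_simps eval_nat_numeral)
    finally have "even (b_reg 3 8 (2 * p ^ (6 * j + 5) * n + (5 * p ^ (2 * (3 * j + 3)) + 7) div 12))"
      unfolding even_b_reg_progression[OF assms] .
    moreover have "2 * (3 * j + 3) = 6 * j + 6" by simp
    ultimately show ?thesis by (simp only:)
  qed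
  show ?thesis
    using first second third by (simp add: cong_0_iff omega)
qed

end
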